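(* The surface $\dot{\hat f}\colon M\to\mathbb{C}^2$ with differential $$d\dot{\hat f}=\sqrt{\tfrac32}\begin{pmatrix}e^{-\frac{\pi i}3}z\\-e^{\frac{\pi i}3}\end{pmatrix}\frac{dz}{z^3-1}+\sqrt{\tfrac32}\begin{pmatrix}e^{\frac{\pi i}6}\\-e^{-\frac{\pi i}6}\bar z\end{pmatrix}\frac{d\bar z}{\bar z^3-1}$$ (the Scherk minimal Lagrangian surface) is properly embedded.
   Context: $\zeta=e^{2\pi i/3}$, and $M\to\mathbb{CP}^1\setminus\{1,\zeta,\zeta^2\}$ is the universal abelian covering, i.e. the quotient of the universal covering of $\mathbb{CP}^1\setminus\{1,\zeta,\zeta^2\}$ by the commutator subgroup of $\pi_1(\mathbb{CP}^1\setminus\{1,\zeta,\zeta^2\})$. $\dot{\hat f}$ is a primitive (unique up to translation, well defined on $M$) of the displayed closed $\mathbb{C}^2$-valued 1-form; $z$ is the standard affine coordinate. *)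

theory Defs
  imports "HOL-Analysis.Analysis" "HOL-Algebra.Bij" "HOL-Algebra.Generated_Groups"
begin

section \<open>The complex projective line\<close>

typedef cp1 = "{L :: (complex^2) set. vec.subspace L \<and> vec.dim L = 1}"
proof
  show "vec.span {axis 1 1} \<in> {L :: (complex^2) set. vec.subspace L \<and> vec.dim L = 1}"
    by (simp add: vec.subspace_span vec.dim_span vec.dim_eq_card_independent axis_eq_0_iff)
qed

definition line :: "complex^2 \<Rightarrow> cp1" where
  "line v = Abs_cp1 (vec.span {v})"

lemma Rep_line: "v \<noteq> 0 \<Longrightarrow> Rep_cp1 (line v) = vec.span {v}"
  unfolding line_def
  by (rule Abs_cp1_inverse)
    (simp add: vec.subspace_span vec.dim_span vec.dim_eq_card_independent)

text \<open>The quotient topology from the space of nonzero vectors.\<close>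

instantiation cp1 :: topological_space
begin

definition open_cp1 :: "cp1 set \<Rightarrow> bool" where
  "open_cp1 S \<longleftrightarrow> open {v. v \<noteq> 0 \<and> line v \<in> S}"

instance
proof
  have "{v. v \<noteq> 0 \<and> line v \<in> (UNIV :: cp1 set)} = - {0 :: complex^2}" by auto
  then show "open (UNIV :: cp1 set)" by (simp add: open_cp1_def open_Compl)
next
  fix S T :: "cp1 set"
  assume "open S" "open T"
  moreover have "{v. v \<noteq> 0 \<and> line v \<in> S \<inter> T}
      = {v. v \<noteq> 0 \<and> line v \<in> S} \<inter> {v. v \<noteq> 0 \<and> line v \<in> T}" by auto
  ultimately show "open (S \<inter> T)" by (simp add: open_cp1_def open_Int)
next
  fix K :: "cp1 set set"
  assume "\<forall>S\<in>K. open S"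
  moreover have "{v. v \<noteq> 0 \<and> line v \<in> \<Union>K} = (\<Union>S\<in>K. {v. v \<noteq> 0 \<and> line v \<in> S})" by auto
  ultimately show "open (\<Union>K)" by (simp add: open_cp1_def open_UN)
qed

end

text \<open>The inverses of the two standard holomorphic charts: \<open>z \<mapsto> [z : 1]\<close>, where \<open>z\<close> is the
  standard affine coordinate, and \<open>w \<mapsto> [1 : w]\<close>, where \<open>w = 1/z\<close>.\<close>

definition aff :: "complex \<Rightarrow> cp1" where
  "aff z = line (vector [z, 1])"

definition aff_inf :: "complex \<Rightarrow> cp1" where
  "aff_inf w = line (vector [1, w])"

lemma aff_inf_eq_aff:
  assumes "w \<noteq> 0"
  shows "aff_inf w = aff (1 / w)"
proof -
  have "vector [1, w] = w *s (vector [1 / w, 1] :: complex^2)"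
    using assms by (simp add: vec_eq_iff forall_2)
  then have "vec.span {vector [1, w]} = vec.span {w *s (vector [1 / w, 1] :: complex^2)}"
    by simp
  also have "\<dots> = vec.span {vector [1 / w, 1]}"
    using assms vec.span_image_scale[of "{vector [1 / w, 1]}" "\<lambda>_. w"] by simp
  finally show ?thesis by (simp add: aff_def aff_inf_def line_def)
qed

definition \<zeta> :: complex where
  "\<zeta> = exp (2 * pi * \<i> / 3)"

definition punctured_cp1 :: "cp1 set" where
  "punctured_cp1 = - {aff 1, aff \<zeta>, aff (\<zeta>\<^sup>2)}"


section \<open>The universal abelian covering\<close>

definition universal_covering ::
    "'u::topological_space set \<Rightarrow> ('u \<Rightarrow> 'b::topological_space) \<Rightarrow> 'b set \<Rightarrow> bool" where
  "universal_covering U q X \<longleftrightarrow> covering_space U q X \<and> simply_connected U"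

definition deck_transformations ::
    "'u::topological_space set \<Rightarrow> ('u \<Rightarrow> 'b) \<Rightarrow> ('u \<Rightarrow> 'u) set" where
  "deck_transformations U q =
     {g \<in> Bij U. homeomorphic_map (top_of_set U) (top_of_set U) g \<and> (\<forall>x\<in>U. q (g x) = q x)}"

text \<open>The library develops covering theory for subsets of real normed spaces. For coverings of a
  surface this is no restriction: their total spaces are metrizable, hence embed into a normed
  space; the universal covering of the thrice punctured sphere is even realised by the unit
  disc in \<open>complex\<close>.\<close>

text \<open>For a universal covering \<open>q\<close> of \<open>X\<close>, the fundamental group of \<open>X\<close> is identified as usual with
  the group of deck transformations of \<open>q\<close>; it is a subgroup of the group of all permutations
  of \<open>U\<close>, so its commutator subgroup can be formed there.\<close>

definition ab_orbit :: "'u::topological_space set \<Rightarrow> ('u \<Rightarrow> 'b) \<Rightarrow> 'u \<Rightarrow> 'u set" where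
  "ab_orbit U q x =
     (\<lambda>g. g x) ` derived (BijGroup U) (deck_transformations U q)"

definition quotient_topology :: "'a topology \<Rightarrow> ('a \<Rightarrow> 'b) \<Rightarrow> 'b topology" where
  "quotient_topology X h =
     topology (\<lambda>V. V \<subseteq> h ` topspace X \<and> openin X {x \<in> topspace X. h x \<in> V})"

lemma openin_quotient_topology:
  "openin (quotient_topology X h) V \<longleftrightarrow>
     V \<subseteq> h ` topspace X \<and> openin X {x \<in> topspace X. h x \<in> V}"
proof -
  have "istopology (\<lambda>V. V \<subseteq> h ` topspace X \<and> openin X {x \<in> topspace X. h x \<in> V})"
    unfolding istopology_def
  proof (intro conjI allI impI)
    fix S T
    assume "S \<subseteq> h ` topspace X \<and> openin X {x \<in> topspace X. h x \<in> S}"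
      and "T \<subseteq> h ` topspace X \<and> openin X {x \<in> topspace X. h x \<in> T}"
    moreover have "{x \<in> topspace X. h x \<in> S \<inter> T}
        = {x \<in> topspace X. h x \<in> S} \<inter> {x \<in> topspace X. h x \<in> T}" by auto
    ultimately show "S \<inter> T \<subseteq> h ` topspace X" "openin X {x \<in> topspace X. h x \<in> S \<inter> T}"
      by (auto simp only: openin_Int)
  next
    fix K
    assume K: "\<forall>S\<in>K. S \<subseteq> h ` topspace X \<and> openin X {x \<in> topspace X. h x \<in> S}"
    then show "\<Union>K \<subseteq> h ` topspace X" by blast
    have "{x \<in> topspace X. h x \<in> \<Union>K} = (\<Union>S\<in>K. {x \<in> topspace X. h x \<in> S})" by auto
    then show "openin X {x \<in> topspace X. h x \<in> \<Union>K}" using K by auto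
  qed
  then show ?thesis by (simp add: quotient_topology_def topology_inverse')
qed

lemma topspace_quotient_topology: "topspace (quotient_topology X h) = h ` topspace X"
proof -
  have "{x \<in> topspace X. h x \<in> h ` topspace X} = topspace X" by auto
  then have "openin (quotient_topology X h) (h ` topspace X)"
    by (simp add: openin_quotient_topology)
  then show ?thesis
    by (metis openin_quotient_topology openin_subset openin_topspace subset_antisym)
qed

lemma quotient_map_quotient_topology: "quotient_map X (quotient_topology X h) h"
  by (simp add: quotient_map_def openin_quotient_topology topspace_quotient_topology)

text \<open>If \<open>q\<close> is a universal covering of \<open>X\<close>, the points of the following space are the
  orbits of the commutator subgroup, and \<open>ab_proj q\<close> is its covering projection onto \<open>X\<close>.\<close>

definition universal_abelian_cover ::
    "'u::topological_space set \<Rightarrow> ('u \<Rightarrow> 'b) \<Rightarrow> 'u set topology" where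
  "universal_abelian_cover U q = quotient_topology (top_of_set U) (ab_orbit U q)"

definition ab_proj :: "('u \<Rightarrow> 'b) \<Rightarrow> 'u set \<Rightarrow> 'b" where
  "ab_proj q m = the_elem (q ` m)"


section \<open>Differentials of maps on the covering\<close>

text \<open>The smooth structure of the covering \<open>M\<close> is the one pulled back along the projection: near
  a point \<open>m\<close> over \<open>\<phi> z\<close>, where \<open>\<phi>\<close> is \<open>aff\<close> or \<open>aff_inf\<close>, it is parametrised by the continuous
  lift of \<open>\<phi>\<close> that maps \<open>z\<close> to \<open>m\<close>. The germ of this lift at \<open>z\<close> is unique.\<close>

definition local_lift ::
    "'m topology \<Rightarrow> ('m \<Rightarrow> cp1) \<Rightarrow> (complex \<Rightarrow> cp1) \<Rightarrow> complex \<Rightarrow> 'm \<Rightarrow> (complex \<Rightarrow> 'm) \<Rightarrow> bool" where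
  "local_lift M p \<phi> z m s \<longleftrightarrow>
     s z = m \<and> (\<exists>N. open N \<and> z \<in> N \<and> continuous_map (top_of_set N) M s \<and> (\<forall>t\<in>N. p (s t) = \<phi> t))"

text \<open>The differential of \<open>f\<close> at \<open>m\<close>, expressed in the local coordinate belonging to \<open>\<phi>\<close>.\<close>

definition has_differential ::
    "'m topology \<Rightarrow> ('m \<Rightarrow> cp1) \<Rightarrow> ('m \<Rightarrow> complex^2) \<Rightarrow> (complex \<Rightarrow> cp1) \<Rightarrow> complex \<Rightarrow> 'm
      \<Rightarrow> (complex \<Rightarrow> complex^2) \<Rightarrow> bool" where
  "has_differential M p f \<phi> z m D \<longleftrightarrow>
     (\<exists>s. local_lift M p \<phi> z m s \<and> ((f \<circ> s) has_derivative D) (at z))"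

definition immersion :: "'m topology \<Rightarrow> ('m \<Rightarrow> cp1) \<Rightarrow> ('m \<Rightarrow> complex^2) \<Rightarrow> bool" where
  "immersion M p f \<longleftrightarrow>
     (\<forall>m \<in> topspace M. \<exists>\<phi> \<in> {aff, aff_inf}. \<exists>z D.
        p m = \<phi> z \<and> has_differential M p f \<phi> z m D \<and> inj D)"

text \<open>Smoothness of \<open>f\<close> is not repeated here, because below the differential of \<open>f\<close> is a given
  smooth form. For continuous maps into \<open>complex^2\<close>, \<open>proper_map\<close> says that preimages
  of compact sets are compact.\<close>

definition properly_embedded :: "'m topology \<Rightarrow> ('m \<Rightarrow> cp1) \<Rightarrow> ('m \<Rightarrow> complex^2) \<Rightarrow> bool" where
  "properly_embedded M p f \<longleftrightarrow>
     immersion M p f \<and> embedding_map M euclidean f \<and> proper_map M euclidean f"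


section \<open>The Scherk minimal Lagrangian surface\<close>

text \<open>The value of the 1-form at the point with affine coordinate \<open>z\<close>, on a tangent vector with
  \<open>dz = h\<close>.\<close>

definition scherk_form :: "complex \<Rightarrow> complex \<Rightarrow> complex^2" where
  "scherk_form z h =
     complex_of_real (sqrt (3 / 2)) *s
       ((h / (z ^ 3 - 1)) *s vector [exp (- (pi * \<i> / 3)) * z, - exp (pi * \<i> / 3)])
   + complex_of_real (sqrt (3 / 2)) *s
       ((cnj h / (cnj z ^ 3 - 1)) *s vector [exp (pi * \<i> / 6), - (exp (- (pi * \<i> / 6)) * cnj z)])"

text \<open>The same form in the coordinate \<open>w = 1/z\<close>, where \<open>z dz / (z\<^sup>3 - 1) = - dw / (1 - w\<^sup>3)\<close> and
  \<open>dz / (z\<^sup>3 - 1) = - w dw / (1 - w\<^sup>3)\<close>; it extends smoothly over \<open>w = 0\<close>, that is \<open>z = \<infinity>\<close>.\<close>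

definition scherk_form_inf :: "complex \<Rightarrow> complex \<Rightarrow> complex^2" where
  "scherk_form_inf w h =
     complex_of_real (sqrt (3 / 2)) *s
       ((- h / (1 - w ^ 3)) *s vector [exp (- (pi * \<i> / 3)), - (exp (pi * \<i> / 3) * w)])
   + complex_of_real (sqrt (3 / 2)) *s
       ((- cnj h / (1 - cnj w ^ 3)) *s vector [exp (pi * \<i> / 6) * cnj w, - exp (- (pi * \<i> / 6))])"

lemma scherk_form_inf_eq:
  assumes "w \<noteq> 0"
  shows "scherk_form_inf w h = scherk_form (1 / w) (- h / w\<^sup>2)"
proof -
  have 1: "(- k / v\<^sup>2) / ((1 / v) ^ 3 - 1) = v * (- k / (1 - v ^ 3))" if "v \<noteq> 0" for k v :: complex
  proof (cases "v ^ 3 = 1")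
    case True
    then show ?thesis using that by (simp add: power_divide)
  next
    case False
    then have "1 - v ^ 3 \<noteq> 0" "(1 / v) ^ 3 - 1 \<noteq> 0" using that by (auto simp: power_divide)
    then show ?thesis using that
      by (simp add: divide_simps) (simp add: algebra_simps power2_eq_square power3_eq_cube)
  qed
  show ?thesis
    using assms 1[of w h] 1[of "cnj w" "cnj h"]
    by (simp add: scherk_form_def scherk_form_inf_def vec_eq_iff forall_2) (simp add: mult_ac)
qed

text \<open>\<open>f\<close> is a primitive on the covering \<open>M\<close> of the pulled back 1-form.\<close>

definition scherk_surface :: "'m topology \<Rightarrow> ('m \<Rightarrow> cp1) \<Rightarrow> ('m \<Rightarrow> complex^2) \<Rightarrow> bool" where
  "scherk_surface M p f \<longleftrightarrow>
     (\<forall>m \<in> topspace M.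
        (\<forall>z. p m = aff z \<longrightarrow> has_differential M p f aff z m (scherk_form z)) \<and>
        (\<forall>w. p m = aff_inf w \<longrightarrow> has_differential M p f aff_inf w m (scherk_form_inf w)))"

end

theory Submission
  imports Defs
begin

text \<open>In the coordinate \<open>w = (\<zeta> - \<zeta> z) / (z - \<zeta>\<^sup>2)\<close> the punctures are \<open>0, 1, \<infinity>\<close>, and the pair
  \<open>(log w, log (w - 1))\<close> is well defined on the universal abelian cover. It maps the cover
  homeomorphically onto the closed complex curve \<open>exp a - exp b = 1\<close>: a deck transformation of the
  universal cover is in the commutator subgroup iff it does not change the two logarithms, because
  the deck group is generated by two elements that shift them by \<open>(2 \<pi> \<i>, 0)\<close> and \<open>(0, - 2 \<pi> \<i>)\<close>.
  The Scherk surface is the composition of this map with an injective real linear map and a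
  translation, so it is an embedding with closed image, and no growth estimate is needed.\<close>

section \<open>Groups generated by two elements\<close>

text \<open>The poles of \<open>1 / (z ^ 3 - 1)\<close> and \<open>z / (z ^ 3 - 1)\<close> are
  simple and the residues of each function sum to zero. Hence both forms
  \<open>dz / (z ^ 3 - 1)\<close> and \<open>z dz / (z ^ 3 - 1)\<close> are combinations of
  \<open>d log w\<close> and \<open>d log (w - 1)\<close> with constant coefficients; the conjugate
  terms of the Scherk form make the resulting map only real linear. Its injectivity is the special
  feature of the form: the phases in front of a term and of its conjugate partner differ by a
  quarter turn, which leaves no nonzero kernel. The obstacle is that the cover is defined through
  commutators: a deck transformation that fixes both logarithms has to be recognised as a product of
  commutators. In the abelianised deck group every class is a product of powers of the two
  generators, and the logarithmic shifts read off the exponents. The generators arise from gluing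
  the three slit planes of the base along the upper half plane.\<close>

lemma (in group) additive_one:
  fixes W :: "'a \<Rightarrow> 'v::real_vector"
  assumes W: "\<And>x y. x \<in> carrier G \<Longrightarrow> y \<in> carrier G \<Longrightarrow> W (x \<otimes> y) = W x + W y"
  shows "W \<one> = 0"
  using W[of \<one> \<one>] by simp

lemma (in group) additive_inv:
  fixes W :: "'a \<Rightarrow> 'v::real_vector"
  assumes W: "\<And>x y. x \<in> carrier G \<Longrightarrow> y \<in> carrier G \<Longrightarrow> W (x \<otimes> y) = W x + W y"
    and x: "x \<in> carrier G"
  shows "W (inv x) = - W x"
  using W[of "inv x" x] x additive_one[of W, OF W] by (simp add: eq_neg_iff_add_eq_0)

lemma (in group) additive_int_pow:
  fixes W :: "'a \<Rightarrow> 'v::real_vector"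
  assumes W: "\<And>x y. x \<in> carrier G \<Longrightarrow> y \<in> carrier G \<Longrightarrow> W (x \<otimes> y) = W x + W y"
    and x: "x \<in> carrier G"
  shows "W (x [^] (k::int)) = of_int k *\<^sub>R W x"
proof -
  have nat_pow: "W (x [^] (n::nat)) = of_nat n *\<^sub>R W x" for n
    by (induction n) (simp_all add: W x additive_one[of W, OF W] algebra_simps)
  show ?thesis
  proof (cases "k < 0")
    case True
    have "W (x [^] k) = W (inv (x [^] (nat (- k))))"
      using True by (simp only: int_pow_def2 if_True)
    also have "\<dots> = - W (x [^] (nat (- k)))"
      using x by (intro additive_inv[of W, OF W] nat_pow_closed)
    finally show ?thesis using True unfolding nat_pow by simp
  next
    case False
    have "W (x [^] k) = W (x [^] (nat k))"
      using False by (simp only: int_pow_def2 if_False)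
    then show ?thesis using False unfolding nat_pow by simp
  qed
qed

text \<open>A commutator is sent to zero because addition in the target is commutative; the
  induction extends this to products and inverses of commutators.\<close>

lemma (in group) additive_derived:
  fixes W :: "'a \<Rightarrow> 'v::real_vector"
  assumes W: "\<And>x y. x \<in> carrier G \<Longrightarrow> y \<in> carrier G \<Longrightarrow> W (x \<otimes> y) = W x + W y"
    and d: "d \<in> derived G (carrier G)"
  shows "W d = 0"
proof -
  have cl: "derived_set G (carrier G) \<subseteq> carrier G" by auto
  from d[unfolded derived_def] show ?thesis
  proof (induction d rule: generate.induct)
    case one
    then show ?case using additive_one[of W, OF W] by simp
  next
    case (incl h)
    then show ?case by (auto simp: W additive_inv[of W, OF W])
  next
    case (inv h)
    then show ?case by (auto simp: W additive_inv[of W, OF W])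
  next
    case (eng h1 h2)
    then have "h1 \<in> carrier G" "h2 \<in> carrier G"
      using generate_in_carrier[OF cl] by auto
    with eng show ?case by (simp add: W)
  qed
qed

text \<open>Modulo the commutator subgroup the group is abelian, so each class is a product of a
  power of \<open>a\<close> and a power of \<open>b\<close>. The independence of \<open>W a\<close>
  and \<open>W b\<close> over the integers forces both exponents of an element of the kernel to
  vanish.\<close>

lemma (in group) additive_kernel_derived:
  fixes W :: "'a \<Rightarrow> 'v::real_vector"
  assumes W: "\<And>x y. x \<in> carrier G \<Longrightarrow> y \<in> carrier G \<Longrightarrow> W (x \<otimes> y) = W x + W y"
    and ab: "a \<in> carrier G" "b \<in> carrier G"
    and gen: "carrier G = generate G {a, b}"
    and indep: "\<And>m n::int. of_int m *\<^sub>R W a + of_int n *\<^sub>R W b = 0 \<Longrightarrow> m = 0 \<and> n = 0"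
    and g: "g \<in> carrier G" "W g = 0"
  shows "g \<in> derived G (carrier G)"
proof -
  define D where "D = derived G (carrier G)"
  interpret D: normal D G unfolding D_def by (rule derived_self_is_normal)
  interpret Q: comm_group "G Mod D" unfolding D_def by (rule derived_quot_is_comm_group)
  \<comment> \<open>Keeps the unit and the product of the quotient folded, so that the rules of the
    interpretation \<open>Q\<close> match them.\<close>
  note [simp del] = one_FactGroup mult_FactGroup
  define r where "r x = D #> x" for x
  have r_hom: "r (x \<otimes> y) = r x \<otimes>\<^bsub>G Mod D\<^esub> r y" if "x \<in> carrier G" "y \<in> carrier G" for x y
    using that by (simp add: r_def FactGroup_def D.rcos_sum)
  have r_car: "r x \<in> carrier (G Mod D)" if "x \<in> carrier G" for x
    using that by (auto simp: r_def FactGroup_def RCOSETS_def)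
  have r_one: "r \<one> = \<one>\<^bsub>G Mod D\<^esub>"
    by (simp add: r_def FactGroup_def D.subset)
  have r_inv: "r (inv x) = inv\<^bsub>G Mod D\<^esub> (r x)" if "x \<in> carrier G" for x
    using that r_hom[of "inv x" x] r_car r_one
    by (intro Q.inv_equality[symmetric]) auto
  \<comment> \<open>The same exponents have to serve for the coset and for the value of
    \<open>W\<close>, hence one induction for both.\<close>
  have key: "\<exists>m n::int. r x = r a [^]\<^bsub>G Mod D\<^esub> m \<otimes>\<^bsub>G Mod D\<^esub> r b [^]\<^bsub>G Mod D\<^esub> n
      \<and> W x = of_int m *\<^sub>R W a + of_int n *\<^sub>R W b" if "x \<in> generate G {a, b}" for x
    using that
  proof (induction x rule: generate.induct)
    case one
    show ?case
      by (rule exI[of _ 0], rule exI[of _ 0]) (use Q.l_one[OF Q.one_closed] in \<open>simp add: r_one additive_one[of W, OF W]\<close>)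
  next
    case (incl h)
    then consider "h = a" | "h = b" by auto
    then show ?case
    proof cases
      case 1
      show ?thesis
        by (rule exI[of _ 1], rule exI[of _ 0]) (simp add: 1 r_car ab Q.int_pow_1)
    next
      case 2
      show ?thesis
        by (rule exI[of _ 0], rule exI[of _ 1]) (simp add: 2 r_car ab Q.int_pow_1)
    qed
  next
    case (inv h)
    then consider "h = a" | "h = b" by auto
    then show ?case
    proof cases
      case 1
      show ?thesis
        by (rule exI[of _ "-1"], rule exI[of _ 0])
          (simp add: 1 r_car r_inv ab Q.int_pow_neg Q.int_pow_1 additive_inv[of W, OF W])
    next
      case 2
      show ?thesis
        by (rule exI[of _ 0], rule exI[of _ "-1"])
          (simp add: 2 r_car r_inv ab Q.int_pow_neg Q.int_pow_1 additive_inv[of W, OF W])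
    qed
  next
    case (eng h1 h2)
    obtain m n where 1: "r h1 = r a [^]\<^bsub>G Mod D\<^esub> m \<otimes>\<^bsub>G Mod D\<^esub> r b [^]\<^bsub>G Mod D\<^esub> (n::int)"
      "W h1 = of_int m *\<^sub>R W a + of_int n *\<^sub>R W b" using eng.IH(1) by blast
    obtain m' n' where 2: "r h2 = r a [^]\<^bsub>G Mod D\<^esub> m' \<otimes>\<^bsub>G Mod D\<^esub> r b [^]\<^bsub>G Mod D\<^esub> (n'::int)"
      "W h2 = of_int m' *\<^sub>R W a + of_int n' *\<^sub>R W b" using eng.IH(2) by blast
    have h: "h1 \<in> carrier G" "h2 \<in> carrier G" using eng.hyps gen by auto
    show ?case
    proof (rule exI[of _ "m + m'"], rule exI[of _ "n + n'"], rule conjI)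
      show "r (h1 \<otimes> h2) = r a [^]\<^bsub>G Mod D\<^esub> (m + m') \<otimes>\<^bsub>G Mod D\<^esub> r b [^]\<^bsub>G Mod D\<^esub> (n + n')"
        using h r_car ab by (simp add: r_hom 1 2 Q.int_pow_mult Q.m_ac Q.int_pow_closed)
      show "W (h1 \<otimes> h2) = of_int (m + m') *\<^sub>R W a + of_int (n + n') *\<^sub>R W b"
        using h by (simp add: W 1 2 algebra_simps)
    qed
  qed
  obtain m n :: int where
    mn: "r g = r a [^]\<^bsub>G Mod D\<^esub> m \<otimes>\<^bsub>G Mod D\<^esub> r b [^]\<^bsub>G Mod D\<^esub> n"
      "W g = of_int m *\<^sub>R W a + of_int n *\<^sub>R W b"
    using key g(1) gen by blast
  have "m = 0" "n = 0" using indep[of m n] mn(2) g(2) by auto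
  then have "r g = \<one>\<^bsub>G Mod D\<^esub>" using mn(1) by simp
  then have "r g = D" by (simp add: FactGroup_def)
  then show ?thesis
    using g(1) rcos_self[OF g(1) D.subgroup_axioms] by (simp add: r_def D_def)
qed

section \<open>Deck transformations of a simply connected covering\<close>

locale simply_connected_covering =
  fixes U :: "'u::real_normed_vector set" and p :: "'u \<Rightarrow> 'b::real_normed_vector" and X :: "'b set"
  assumes cov: "covering_space U p X" and sc: "simply_connected U"
    and lpc: "locally path_connected X"
begin

abbreviation "deck \<equiv> deck_transformations U p"

lemma p_in: "x \<in> U \<Longrightarrow> p x \<in> X"
  using covering_space_imp_surjective[OF cov] by auto

lemma p_cont: "continuous_on U p"
  by (rule covering_space_imp_continuous[OF cov])

lemma connected_U: "connected U"
  using sc by (rule simply_connected_imp_connected)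

lemma lpc_U: "locally path_connected U"
  using covering_space_locally_path_connected_eq[OF cov] lpc by simp

lemma lift_unique:
  fixes g h :: "'c::topological_space \<Rightarrow> 'u"
  assumes "continuous_on T g" "continuous_on T h" "g ` T \<subseteq> U" "h ` T \<subseteq> U"
    "\<And>t. t \<in> T \<Longrightarrow> p (g t) = p (h t)" "connected T" "a \<in> T" "g a = h a" "t \<in> T"
  shows "g t = h t"
proof (rule covering_space_lift_unique[OF cov, of g a h T "\<lambda>t. p (g t)"])
  show "continuous_on T (\<lambda>t. p (g t))"
    using assms by (intro continuous_on_compose2[OF p_cont]) auto
qed (use assms p_in in \<open>auto simp: image_subset_iff\<close>)

lemma exists_lift:
  fixes h :: "'c::real_normed_vector \<Rightarrow> 'b"
  assumes "simply_connected T" "locally path_connected T" "continuous_on T h" "h ` T \<subseteq> X"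
    "t0 \<in> T" "x0 \<in> U" "h t0 = p x0"
  obtains g where "continuous_on T g" "g ` T \<subseteq> U" "g t0 = x0" "\<And>t. t \<in> T \<Longrightarrow> p (g t) = h t"
  using covering_space_lift_strong[OF cov assms(6,5,1,2,3) _ assms(7)] assms(4)
  by (metis Pi_iff image_subset_iff)

lemma deck_map:
  assumes "g \<in> deck"
  shows "g ` U = U" "continuous_on U g" "\<And>x. x \<in> U \<Longrightarrow> p (g x) = p x" "g \<in> Bij U"
    "\<And>x. x \<in> U \<Longrightarrow> g x \<in> U"
proof -
  have "homeomorphic_map (top_of_set U) (top_of_set U) g"
    using assms by (auto simp: deck_transformations_def)
  from homeomorphic_imp_continuous_map[OF this] show "continuous_on U g" by simp
qed (use assms in \<open>auto simp: deck_transformations_def Bij_def bij_betw_def\<close>)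

text \<open>On the connected set \<open>U\<close> both are lifts of \<open>p\<close> that agree at a
  point. Outside \<open>U\<close> they agree because the elements of \<open>Bij U\<close> are
  extensional.\<close>

lemma deck_unique:
  assumes "g \<in> deck" "h \<in> deck" "x \<in> U" "g x = h x"
  shows "g = h"
proof (rule extensionalityI[of _ U])
  show "g \<in> extensional U" "h \<in> extensional U"
    using assms deck_map(4) by (auto simp: Bij_def)
  fix y assume "y \<in> U"
  then show "g y = h y"
    using assms deck_map[OF assms(1)] deck_map[OF assms(2)] connected_U
    by (intro lift_unique[of U g h x y]) auto
qed

text \<open>The lifting theorems leave the values outside \<open>U\<close> unspecified;
  \<open>restrict\<close> turns a lift into an extensional function, as membership in
  \<open>Bij U\<close> demands.\<close>

lemma deckI:
  assumes g: "continuous_on U g" "g ` U \<subseteq> U" "\<And>x. x \<in> U \<Longrightarrow> p (g x) = p x"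
    and h: "continuous_on U h" "h ` U \<subseteq> U"
    and gh: "\<And>x. x \<in> U \<Longrightarrow> g (h x) = x" "\<And>x. x \<in> U \<Longrightarrow> h (g x) = x"
  shows "restrict g U \<in> deck"
proof -
  have "bij_betw g U U"
    by (rule bij_betw_byWitness[of _ h]) (use g h gh in auto)
  then have "restrict g U \<in> Bij U"
    by (simp add: Bij_def cong: bij_betw_cong)
  moreover have "homeomorphic_maps (top_of_set U) (top_of_set U) (restrict g U) h"
    using g h gh by (auto simp: homeomorphic_maps_def image_subset_iff cong: continuous_on_cong)
  then have "homeomorphic_map (top_of_set U) (top_of_set U) (restrict g U)"
    using homeomorphic_map_maps by blast
  ultimately show ?thesis
    using g by (auto simp: deck_transformations_def)
qed

text \<open>Since \<open>U\<close> is simply connected, \<open>p\<close> lifts through itself with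
  prescribed value \<open>y\<close> at \<open>x\<close>, and also with value \<open>x\<close> at
  \<open>y\<close>. The two compositions are lifts of \<open>p\<close> with a fixed point, hence the
  identity.\<close>

lemma deck_transitive:
  assumes "x \<in> U" "y \<in> U" "p x = p y"
  obtains g where "g \<in> deck" "g x = y"
proof -
  obtain g where g: "continuous_on U g" "g ` U \<subseteq> U" "g x = y" "\<And>t. t \<in> U \<Longrightarrow> p (g t) = p t"
    using exists_lift[OF sc lpc_U p_cont _ assms(1,2,3)] p_in by blast
  obtain h where h: "continuous_on U h" "h ` U \<subseteq> U" "h y = x" "\<And>t. t \<in> U \<Longrightarrow> p (h t) = p t"
    using exists_lift[OF sc lpc_U p_cont _ assms(2,1) assms(3)[symmetric]] p_in by blast
  have comp: "continuous_on U (\<lambda>t. g (h t))" "continuous_on U (\<lambda>t. h (g t))"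
    by (rule continuous_on_compose2[OF g(1) h(1,2)], rule continuous_on_compose2[OF h(1) g(1,2)])
  have inv: "g (h t) = t" "h (g t) = t" if "t \<in> U" for t
  proof -
    have "(g \<circ> h) t = id t"
      using g h assms that connected_U
      by (intro lift_unique[of U "g \<circ> h" id y t]) (auto simp: image_subset_iff comp o_def)
    then show "g (h t) = t" by simp
    have "(h \<circ> g) t = id t"
      using g h assms that connected_U
      by (intro lift_unique[of U "h \<circ> g" id x t]) (auto simp: image_subset_iff comp o_def)
    then show "h (g t) = t" by simp
  qed
  have "restrict g U \<in> deck" by (rule deckI[OF g(1,2,4) h(1,2) inv])
  then show ?thesis using that[of "restrict g U"] assms g by simp
qed

lemma deck_mult: "g \<in> deck \<Longrightarrow> h \<in> deck \<Longrightarrow> x \<in> U \<Longrightarrow> (g \<otimes>\<^bsub>BijGroup U\<^esub> h) x = g (h x)"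
  using deck_map(4) by (simp add: BijGroup_def compose_eq)

lemma subgroup_deck: "subgroup deck (BijGroup U)"
proof
  show "deck \<subseteq> carrier (BijGroup U)"
    by (auto simp: BijGroup_def deck_map(4))
  show "\<one>\<^bsub>BijGroup U\<^esub> \<in> deck"
    using deckI[of id id] by (simp add: BijGroup_def id_def)
next
  fix g h assume gh: "g \<in> deck" "h \<in> deck"
  have "compose U g h \<in> Bij U" using gh by (simp add: compose_Bij deck_map(4))
  moreover have "homeomorphic_map (top_of_set U) (top_of_set U) (compose U g h)"
    using homeomorphic_map_compose[of "top_of_set U" "top_of_set U" h "top_of_set U" g] gh
    by (auto simp: deck_transformations_def compose_def elim: homeomorphic_map_eq)
  moreover have "g \<otimes>\<^bsub>BijGroup U\<^esub> h = compose U g h"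
    using gh by (simp add: BijGroup_def deck_map(4))
  moreover have "p (compose U g h x) = p x" if "x \<in> U" for x
    using gh deck_map(3,5) that by (simp add: compose_eq)
  ultimately show "g \<otimes>\<^bsub>BijGroup U\<^esub> h \<in> deck"
    by (simp add: deck_transformations_def)
next
  fix g assume g: "g \<in> deck"
  then have "homeomorphic_map (top_of_set U) (top_of_set U) g"
    by (auto simp: deck_transformations_def)
  then obtain h where "homeomorphic_maps (top_of_set U) (top_of_set U) g h"
    using homeomorphic_map_maps by blast
  then have h: "continuous_on U h" "h ` U \<subseteq> U" "\<And>x. x \<in> U \<Longrightarrow> g (h x) = x" "\<And>x. x \<in> U \<Longrightarrow> h (g x) = x"
    by (auto simp: homeomorphic_maps_def)
  have ph: "p (h x) = p x" if "x \<in> U" for x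
    using deck_map(3)[OF g, of "h x"] h that by auto
  have hd: "restrict h U \<in> deck"
    by (rule deckI[OF h(1,2) ph deck_map(2)[OF g] _ h(4,3)]) (use deck_map(1)[OF g] in auto)
  have "inv\<^bsub>BijGroup U\<^esub> g = restrict h U"
  proof (rule group.inv_equality[OF group_BijGroup])
    show "restrict h U \<otimes>\<^bsub>BijGroup U\<^esub> g = \<one>\<^bsub>BijGroup U\<^esub>"
      using g hd deck_map h by (auto simp: BijGroup_def compose_def)
    show "g \<in> carrier (BijGroup U)" "restrict h U \<in> carrier (BijGroup U)"
      using g hd deck_map(4) by (auto simp: BijGroup_def)
  qed
  then show "inv\<^bsub>BijGroup U\<^esub> g \<in> deck" using hd by simp
qed

section \<open>Local sections and a criterion for a subgroup to be the whole deck group\<close>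

lemma local_section:
  assumes "x \<in> U"
  obtains V \<sigma> where "openin (top_of_set X) V" "p x \<in> V" "continuous_on V \<sigma>" "\<sigma> ` V \<subseteq> U"
    "\<sigma> (p x) = x" "\<And>w. w \<in> V \<Longrightarrow> p (\<sigma> w) = w"
proof -
  obtain T u \<sigma> where "x \<in> T" "openin (top_of_set U) T" "p x \<in> u" "openin (top_of_set X) u"
      "homeomorphism T u p \<sigma>"
    using covering_space_local_homeomorphism[OF cov assms] by blast
  then show ?thesis
    by (intro that[of u \<sigma>]) (auto simp: homeomorphism_def openin_contains_ball)
qed

text \<open>On a sheet \<open>T\<close> around a point of the image, \<open>p\<close> is injective.
  Wherever \<open>\<sigma>\<close> stays inside \<open>T\<close> it therefore inverts
  \<open>p\<close>, and its image contains all points of \<open>T\<close> over that part of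
  \<open>V\<close>.\<close>

lemma openin_section:
  assumes V: "openin (top_of_set X) V" and \<sigma>: "continuous_on V \<sigma>" "\<sigma> ` V \<subseteq> U"
    "\<And>w. w \<in> V \<Longrightarrow> p (\<sigma> w) = w"
  shows "openin (top_of_set U) (\<sigma> ` V)"
proof (subst openin_subopen, intro ballI)
  fix x assume x: "x \<in> \<sigma> ` V"
  then have xU: "x \<in> U" using \<sigma> by auto
  obtain T u s where T: "x \<in> T" "openin (top_of_set U) T" "p x \<in> u" "openin (top_of_set X) u"
      "homeomorphism T u p s"
    using covering_space_local_homeomorphism[OF cov xU] by blast
  define V' where "V' = V \<inter> \<sigma> -` T"
  have "openin (top_of_set V) V'"
    unfolding V'_def using \<sigma> T by (intro continuous_openin_preimage[of _ _ U]) auto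
  then have V': "openin (top_of_set X) V'" using V by (rule openin_trans)
  have "openin (top_of_set U) (U \<inter> p -` V')"
    using V' p_in by (intro continuous_openin_preimage[OF p_cont]) auto
  then have op: "openin (top_of_set U) (T \<inter> (U \<inter> p -` V'))" using T by blast
  have "T \<inter> (U \<inter> p -` V') \<subseteq> \<sigma> ` V"
  proof
    fix y assume y: "y \<in> T \<inter> (U \<inter> p -` V')"
    then have "\<sigma> (p y) \<in> T" "p (\<sigma> (p y)) = p y" "p y \<in> V" using \<sigma> by (auto simp: V'_def)
    then have "\<sigma> (p y) = y" using T(5) y by (metis IntD1 homeomorphism_apply1)
    then show "y \<in> \<sigma> ` V" using \<open>p y \<in> V\<close> by (metis imageI)
  qed
  moreover have "x \<in> T \<inter> (U \<inter> p -` V')"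
    using x T xU \<sigma> by (auto simp: V'_def)
  ultimately show "\<exists>T. openin (top_of_set U) T \<and> x \<in> T \<and> T \<subseteq> \<sigma> ` V" using op by blast
qed

text \<open>The translates by \<open>G0\<close> of the images of the sections form an open and closed subset of \<open>U\<close>.\<close>

lemma deck_eq_subgroup:
  assumes ne: "U \<noteq> {}" and G0: "subgroup G0 (BijGroup U)" "G0 \<subseteq> deck"
    and S: "\<And>V \<sigma>. (V, \<sigma>) \<in> S \<Longrightarrow> openin (top_of_set X) V \<and> continuous_on V \<sigma> \<and> \<sigma> ` V \<subseteq> U
        \<and> (\<forall>w\<in>V. p (\<sigma> w) = w)"
    and X: "\<And>w. w \<in> X \<Longrightarrow> \<exists>(V, \<sigma>)\<in>S. w \<in> V"
    and trans: "\<And>V \<sigma> V' \<sigma>' w. (V, \<sigma>) \<in> S \<Longrightarrow> (V', \<sigma>') \<in> S \<Longrightarrow> w \<in> V \<inter> V' \<Longrightarrow> \<exists>h\<in>G0. \<sigma>' w = h (\<sigma> w)"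
  shows "G0 = deck"
proof (rule antisym[OF G0(2)], rule subsetI)
  fix g assume g: "g \<in> deck"
  define P where "P x \<longleftrightarrow> (\<exists>V \<sigma> w k. (V, \<sigma>) \<in> S \<and> w \<in> V \<and> k \<in> G0 \<and> x = k (\<sigma> w))" for x
  have ex: "\<exists>V \<sigma> w k. (V, \<sigma>) \<in> S \<and> w \<in> V \<and> k \<in> deck \<and> x = k (\<sigma> w)" if "x \<in> U" for x
  proof -
    obtain V \<sigma> where V: "(V, \<sigma>) \<in> S" "p x \<in> V" using X[of "p x"] p_in \<open>x \<in> U\<close> by blast
    then have \<sigma>1: "\<sigma> (p x) \<in> U" "p (\<sigma> (p x)) = p x" using S[OF V(1)] by auto
    then obtain k where "k \<in> deck" "k (\<sigma> (p x)) = x"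
      using deck_transitive[OF \<sigma>1(1) \<open>x \<in> U\<close> \<sigma>1(2)] by blast
    then show ?thesis using V by (intro exI[of _ V] exI[of _ \<sigma>] exI[of _ "p x"] exI[of _ k]) simp
  qed
  \<comment> \<open>Two representations of the same point lie over the same \<open>w\<close>, their
    sections differ there by an element of \<open>G0\<close>, and the deck group acts freely. Hence
    \<open>P\<close> is constant on each translate \<open>k\<close> \<sigma>
    \<open>V\<close>.\<close>
  have P_iff: "P (k (\<sigma> w)) \<longleftrightarrow> k \<in> G0" if k: "(V, \<sigma>) \<in> S" "w \<in> V" "k \<in> deck" for V \<sigma> w k
  proof
    assume "P (k (\<sigma> w))"
    then obtain V' \<sigma>' w' k' where 1: "(V', \<sigma>') \<in> S" "w' \<in> V'" "k' \<in> G0" "k (\<sigma> w) = k' (\<sigma>' w')"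
      unfolding P_def by blast
    have in_U: "\<sigma> w \<in> U" "\<sigma>' w' \<in> U" "p (\<sigma> w) = w" "p (\<sigma>' w') = w'"
      using S[OF k(1)] S[OF 1(1)] k(2) 1(2) by auto
    have k': "k' \<in> deck" using 1(3) G0(2) by blast
    have "w = w'" using 1(4) deck_map(3)[OF k(3) in_U(1)] deck_map(3)[OF k' in_U(2)] in_U by simp
    then obtain h where h: "h \<in> G0" "\<sigma>' w' = h (\<sigma> w)"
      using trans[OF k(1) 1(1), of w] k(2) 1(2) by blast
    have "k' \<otimes>\<^bsub>BijGroup U\<^esub> h \<in> G0" using h 1 G0(1) by (simp add: subgroup.m_closed)
    moreover have "k (\<sigma> w) = (k' \<otimes>\<^bsub>BijGroup U\<^esub> h) (\<sigma> w)"
      using in_U h 1 k' G0(2) by (simp add: deck_mult subset_iff)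
    ultimately show "k \<in> G0" using deck_unique[OF k(3) _ in_U(1)] G0(2) by auto
  next
    assume "k \<in> G0"
    then show "P (k (\<sigma> w))" unfolding P_def using k by blast
  qed
  show "g \<in> G0"
  proof -
    obtain x where x: "x \<in> U" using ne by blast
    obtain V \<sigma> w k where 0: "(V, \<sigma>) \<in> S" "w \<in> V" "k \<in> deck" "x = k (\<sigma> w)" using ex[OF x] by blast
    then have "\<sigma> w \<in> U" using S[OF 0(1)] by auto
    have P1: "P (\<one>\<^bsub>BijGroup U\<^esub> (\<sigma> w))"
      using P_iff[OF 0(1,2), of "\<one>\<^bsub>BijGroup U\<^esub>"] subgroup.one_closed[OF G0(1)] G0(2) by blast
    have "P (g (\<sigma> w))"
    \<comment> \<open>The translates by all of \<open>deck\<close> are open and cover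
      \<open>U\<close>, so \<open>P\<close> is locally constant; connectedness carries it from
      \<open>\<sigma> w\<close> to \<open>g (\<sigma> w)\<close>.\<close>
    proof (rule connected_induction_simple[where P = P, OF connected_U _ _ P1])
      show "g (\<sigma> w) \<in> U" using \<open>\<sigma> w \<in> U\<close> deck_map(5) g by blast
      show "\<one>\<^bsub>BijGroup U\<^esub> (\<sigma> w) \<in> U" using \<open>\<sigma> w \<in> U\<close> by (simp add: BijGroup_def)
      fix y assume "y \<in> U"
      then obtain V' \<sigma>' w' k' where 1: "(V', \<sigma>') \<in> S" "w' \<in> V'" "k' \<in> deck" "y = k' (\<sigma>' w')"
        using ex by blast
      have V': "openin (top_of_set X) V'" "continuous_on V' \<sigma>'" "\<sigma>' ` V' \<subseteq> U" "\<forall>w\<in>V'. p (\<sigma>' w) = w"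
        using S[OF 1(1)] by auto
      have "openin (top_of_set U) ((k' \<circ> \<sigma>') ` V')"
      proof (rule openin_section[OF V'(1)])
        show "continuous_on V' (k' \<circ> \<sigma>')"
          unfolding o_def by (rule continuous_on_compose2[OF deck_map(2)[OF 1(3)] V'(2,3)])
      qed (use V' deck_map(3,5)[OF 1(3)] in \<open>auto simp: image_subset_iff\<close>)
      moreover have "\<forall>a\<in>(k' \<circ> \<sigma>') ` V'. \<forall>b\<in>(k' \<circ> \<sigma>') ` V'. P a \<longrightarrow> P b"
        using P_iff[OF 1(1) _ 1(3)] by auto
      ultimately show "\<exists>T. openin (top_of_set U) T \<and> y \<in> T \<and> (\<forall>x\<in>T. \<forall>y\<in>T. P x \<longrightarrow> P y)"
        using 1 by auto
    qed
    then show ?thesis using P_iff[OF 0(1,2) g] by blast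
  qed
qed

end

section \<open>The twice punctured plane\<close>

text \<open>The difference \<open>f - g\<close> lifts the constant \<open>c\<close> through
  \<open>exp\<close>, so it is constant by uniqueness of lifts. The factor \<open>c\<close> permits
  comparison with branches such as \<open>Ln (- w)\<close> and \<open>Ln (1 - w)\<close>.\<close>

lemma log_diff_constant:
  fixes f g :: "'c::topological_space \<Rightarrow> complex"
  assumes "connected T" "continuous_on T f" "continuous_on T g"
    "\<And>t. t \<in> T \<Longrightarrow> exp (f t) = c * exp (g t)" "s \<in> T" "t \<in> T"
  shows "f t - f s = g t - g s"
proof -
  have c: "exp (f u - g u) = c" if "u \<in> T" for u
    using assms(4)[OF that] by (simp add: exp_diff)
  have "c \<noteq> 0" using c[OF assms(5)] by auto
  have "(\<lambda>u. f u - g u) t = (\<lambda>u. f s - g s) t"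
    by (rule covering_space_lift_unique[OF covering_space_exp_punctured_plane,
          of "\<lambda>u. f u - g u" s "\<lambda>u. f s - g s" T "\<lambda>u. c"])
      (use assms c \<open>c \<noteq> 0\<close> in \<open>auto intro!: continuous_intros\<close>)
  then show ?thesis by (simp add: algebra_simps)
qed

text \<open>Both open half planes joined through the gap \<open>I\<close> of the real axis. The gaps
  used below are the three intervals into which 0 and 1 divide the axis.\<close>

definition slit_plane :: "real set \<Rightarrow> complex set" where
  "slit_plane I = {w. Im w \<noteq> 0 \<or> Re w \<in> I}"

lemma open_slit_plane:
  assumes "open I"
  shows "open (slit_plane I)"
proof -
  have "slit_plane I = {w. Im w \<noteq> 0} \<union> Re -` I" by (auto simp: slit_plane_def)
  moreover have "open {w. Im w \<noteq> 0}"
    by (intro open_Collect_neq continuous_intros)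
  moreover have "open (Re -` I)"
    using assms by (intro open_vimage continuous_intros)
  ultimately show ?thesis by auto
qed

text \<open>A segment from a real point of \<open>I\<close> either leaves the axis at once or stays
  on it within \<open>I\<close>. Starlikeness gives the simple connectivity that produces sections
  over slit planes.\<close>

lemma starlike_slit_plane:
  assumes "convex I" "a \<in> I"
  shows "starlike (slit_plane I)"
  unfolding starlike_def
proof (rule bexI[of _ "of_real a"], intro ballI subsetI)
  show "complex_of_real a \<in> slit_plane I" using assms by (simp add: slit_plane_def)
  fix w v assume w: "w \<in> slit_plane I" and v: "v \<in> closed_segment (complex_of_real a) w"
  then obtain u where u: "0 \<le> u" "u \<le> 1" "v = (1 - u) *\<^sub>R complex_of_real a + u *\<^sub>R w"
    by (auto simp: in_segment)
  have ImRe: "Im v = u * Im w" "Re v = (1 - u) * a + u * Re w" using u by auto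
  show "v \<in> slit_plane I"
  proof (cases "Im w = 0 \<or> u = 0")
    case True
    then have "Re v \<in> I"
    proof
      assume "Im w = 0"
      then have "Re w \<in> I" using w by (simp add: slit_plane_def)
      then show ?thesis
        using convexD[OF assms(1) assms(2), of "Re w" "1 - u" u] u by (simp add: ImRe)
    qed (use assms ImRe in auto)
    then show ?thesis by (simp add: slit_plane_def)
  next
    case False
    then show ?thesis by (simp add: slit_plane_def ImRe)
  qed
qed

lemma half_planes_in_slit_plane: "Im w \<noteq> 0 \<Longrightarrow> w \<in> slit_plane I"
  by (simp add: slit_plane_def)

text \<open>For logarithms \<open>a\<close> of \<open>w\<close> and \<open>b\<close> of
  \<open>w - 1\<close> this is the identity \<open>w - (w - 1) = 1\<close>.\<close>

definition log_curve :: "(complex \<times> complex) set" where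
  "log_curve = {(a, b). exp a - exp b = 1}"

lemma closed_log_curve: "closed log_curve"
proof -
  have "log_curve = {x. exp (fst x) - exp (snd x) = 1}" by (auto simp: log_curve_def)
  moreover have "closed {x :: complex \<times> complex. exp (fst x) - exp (snd x) = 1}"
    by (intro closed_Collect_eq continuous_intros)
  ultimately show ?thesis by simp
qed

locale twice_punctured_covering =
  fixes U :: "'u::real_normed_vector set" and p :: "'u \<Rightarrow> complex"
  assumes covering: "covering_space U p (- {0, 1})" and simply_connected: "simply_connected U"

sublocale twice_punctured_covering \<subseteq> simply_connected_covering U p "- {0, 1}"
proof
  have "open (- {0, 1 :: complex})" by (intro open_Compl finite_imp_closed) auto
  then show "locally path_connected (- {0, 1 :: complex})" by (rule open_imp_locally_path_connected)
qed (rule covering simply_connected)+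

context twice_punctured_covering
begin

lemma open_base: "open (- {0, 1 :: complex})"
  by (intro open_Compl finite_imp_closed) auto

lemma p_not_01: "x \<in> U \<Longrightarrow> p x \<noteq> 0" "x \<in> U \<Longrightarrow> p x \<noteq> 1"
  using p_in by auto

section \<open>Logarithms of \<open>p\<close> and \<open>p - 1\<close> and their monodromy\<close>

lemma exists_logarithm:
  assumes "continuous_on U h" "\<And>x. x \<in> U \<Longrightarrow> h x \<noteq> (0::complex)"
  shows "\<exists>L. continuous_on U L \<and> (\<forall>x\<in>U. exp (L x) = h x)"
proof -
  obtain L where "continuous_on U L" "L \<in> U \<rightarrow> UNIV" "\<And>y. y \<in> U \<Longrightarrow> exp (L y) = h y"
    using covering_space_lift[OF covering_space_exp_punctured_plane sc lpc_U assms(1)] assms(2)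
    by auto
  then show ?thesis by auto
qed

definition L0 :: "'u \<Rightarrow> complex" where
  "L0 = (SOME L. continuous_on U L \<and> (\<forall>x\<in>U. exp (L x) = p x))"

definition L1 :: "'u \<Rightarrow> complex" where
  "L1 = (SOME L. continuous_on U L \<and> (\<forall>x\<in>U. exp (L x) = p x - 1))"

lemma L0: "continuous_on U L0" "x \<in> U \<Longrightarrow> exp (L0 x) = p x"
  using someI_ex[OF exists_logarithm[OF p_cont p_not_01(1)]] by (auto simp: L0_def)

lemma L1: "continuous_on U L1" "x \<in> U \<Longrightarrow> exp (L1 x) = p x - 1"
proof -
  have "continuous_on U (\<lambda>x. p x - 1)" by (intro continuous_intros p_cont)
  from someI_ex[OF exists_logarithm[OF this]] p_not_01(2)
  show "continuous_on U L1" "x \<in> U \<Longrightarrow> exp (L1 x) = p x - 1" by (auto simp: L1_def)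
qed

definition \<Lambda> :: "'u \<Rightarrow> complex \<times> complex" where
  "\<Lambda> x = (L0 x, L1 x)"

lemma continuous_\<Lambda>: "continuous_on U \<Lambda>"
  unfolding \<Lambda>_def by (intro continuous_intros L0 L1)

lemma \<Lambda>_in_curve: "x \<in> U \<Longrightarrow> \<Lambda> x \<in> log_curve"
  by (simp add: \<Lambda>_def log_curve_def L0 L1)

lemma p_eq_if_\<Lambda>_eq: "x \<in> U \<Longrightarrow> y \<in> U \<Longrightarrow> \<Lambda> x = \<Lambda> y \<Longrightarrow> p x = p y"
  by (metis L0(2) \<Lambda>_def prod.inject)

text \<open>The value \<open>\<i>\<close> lies in the upper half plane, which is common to all slit
  planes, so the sections over them can be normalised by the same point.\<close>

definition base_point :: 'u where "base_point = (SOME x. x \<in> U \<and> p x = \<i>)"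

lemma base_point: "base_point \<in> U" "p base_point = \<i>"
proof -
  have "\<i> \<in> p ` U" using covering_space_imp_surjective[OF cov] by (simp add: complex_eq_iff)
  then have "\<exists>x. x \<in> U \<and> p x = \<i>" by auto
  from someI_ex[OF this] show "base_point \<in> U" "p base_point = \<i>" by (auto simp: base_point_def)
qed

definition W :: "('u \<Rightarrow> 'u) \<Rightarrow> complex \<times> complex" where
  "W g = \<Lambda> (g base_point) - \<Lambda> base_point"

text \<open>Composition with \<open>g\<close> changes neither \<open>p\<close> nor
  \<open>p - 1\<close>, so each logarithm changes by a constant on the connected set
  \<open>U\<close>. In particular \<open>W\<close> does not depend on the base point, which makes it
  additive.\<close>

lemma W_eq:
  assumes g: "g \<in> deck" and x: "x \<in> U"
  shows "\<Lambda> (g x) - \<Lambda> x = W g"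
proof -
  have comp: "continuous_on U (\<lambda>t. L0 (g t))" "continuous_on U (\<lambda>t. L1 (g t))"
    using deck_map[OF g] by (auto intro!: continuous_on_compose2[OF L0(1)] continuous_on_compose2[OF L1(1)])
  have "L0 (g x) - L0 (g base_point) = L0 x - L0 base_point"
    using deck_map[OF g] x L0
    by (intro log_diff_constant[OF connected_U comp(1) L0(1), of 1] base_point) auto
  moreover have "L1 (g x) - L1 (g base_point) = L1 x - L1 base_point"
    using deck_map[OF g] x L1
    by (intro log_diff_constant[OF connected_U comp(2) L1(1), of 1] base_point) auto
  ultimately show ?thesis by (simp add: W_def \<Lambda>_def algebra_simps)
qed

lemma W_mult:
  assumes "g \<in> deck" "h \<in> deck"
  shows "W (g \<otimes>\<^bsub>BijGroup U\<^esub> h) = W g + W h"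
  using W_eq[OF assms(1) deck_map(5)[OF assms(2) base_point(1)]] base_point
  by (simp add: W_def[of "g \<otimes>\<^bsub>BijGroup U\<^esub> h"] W_def[of h] deck_mult assms algebra_simps)

section \<open>Sections over slit planes and generators of the deck group\<close>

lemma slit_section:
  assumes I: "convex I" "open I" "I \<noteq> {}" "0 \<notin> I" "1 \<notin> I"
  obtains \<sigma> where "openin (top_of_set (- {0, 1})) (slit_plane I)" "continuous_on (slit_plane I) \<sigma>"
    "\<sigma> ` slit_plane I \<subseteq> U" "\<And>w. w \<in> slit_plane I \<Longrightarrow> p (\<sigma> w) = w" "\<sigma> \<i> = base_point"
proof -
  obtain a where "a \<in> I" using I by blast
  have sub: "slit_plane I \<subseteq> - {0, 1}" using I by (auto simp: slit_plane_def)
  have sl: "starlike (slit_plane I)" by (rule starlike_slit_plane[OF I(1) \<open>a \<in> I\<close>])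
  obtain \<sigma> where "continuous_on (slit_plane I) \<sigma>" "\<sigma> ` slit_plane I \<subseteq> U" "\<sigma> \<i> = base_point"
      "\<And>t. t \<in> slit_plane I \<Longrightarrow> p (\<sigma> t) = t"
    using exists_lift[of "slit_plane I" "\<lambda>w. w" \<i> base_point] sl open_slit_plane[OF I(2)] sub
    by (auto simp: starlike_imp_simply_connected open_imp_locally_path_connected
        half_planes_in_slit_plane base_point)
  then show ?thesis
    using open_slit_plane[OF I(2)] sub open_base by (intro that[of \<sigma>]) (auto simp: openin_open_eq)
qed

text \<open>Reduces the change of \<open>L0\<close> and \<open>L1\<close> along a path from
  \<open>\<i>\<close> to \<open>- \<i>\<close> through the gap \<open>I\<close> to the values of an
  explicit branch \<open>g\<close> at these two points.\<close>

lemma section_log_diff: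
  assumes \<sigma>: "continuous_on (slit_plane I) \<sigma>" "\<sigma> ` slit_plane I \<subseteq> U"
      "\<And>w. w \<in> slit_plane I \<Longrightarrow> p (\<sigma> w) = w"
    and I: "convex I" "I \<noteq> {}" and g: "continuous_on (slit_plane I) g"
  shows "(\<And>w. w \<in> slit_plane I \<Longrightarrow> w = c * exp (g w)) \<Longrightarrow>
      L0 (\<sigma> (- \<i>)) - L0 (\<sigma> \<i>) = g (- \<i>) - g \<i>"
    and "(\<And>w. w \<in> slit_plane I \<Longrightarrow> w - 1 = c * exp (g w)) \<Longrightarrow>
      L1 (\<sigma> (- \<i>)) - L1 (\<sigma> \<i>) = g (- \<i>) - g \<i>"
proof -
  obtain a where "a \<in> I" using I by blast
  then have conn: "connected (slit_plane I)"
    using starlike_slit_plane[OF I(1)] by (simp add: starlike_imp_connected)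
  have i: "\<i> \<in> slit_plane I" "- \<i> \<in> slit_plane I" by (auto simp: half_planes_in_slit_plane)
  have c: "continuous_on (slit_plane I) (\<lambda>w. L0 (\<sigma> w))" "continuous_on (slit_plane I) (\<lambda>w. L1 (\<sigma> w))"
    using continuous_on_compose2[OF L0(1) \<sigma>(1,2)] continuous_on_compose2[OF L1(1) \<sigma>(1,2)] by auto
  show "(\<And>w. w \<in> slit_plane I \<Longrightarrow> w = c * exp (g w)) \<Longrightarrow> L0 (\<sigma> (- \<i>)) - L0 (\<sigma> \<i>) = g (- \<i>) - g \<i>"
    using \<sigma> i L0(2) by (intro log_diff_constant[OF conn c(1) g, of c]) (auto simp: image_subset_iff)
  show "(\<And>w. w \<in> slit_plane I \<Longrightarrow> w - 1 = c * exp (g w)) \<Longrightarrow> L1 (\<sigma> (- \<i>)) - L1 (\<sigma> \<i>) = g (- \<i>) - g \<i>"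
    using \<sigma> i L1(2) by (intro log_diff_constant[OF conn c(2) g, of c]) (auto simp: image_subset_iff)
qed

text \<open>Two sections over slit planes that agree at \<open>\<i>\<close> differ over the lower half plane by the
  deck transformation of the loop that crosses the two gaps.\<close>

lemma compare_sections:
  assumes "continuous_on (slit_plane I) \<sigma>" "\<sigma> ` slit_plane I \<subseteq> U"
      "\<And>w. w \<in> slit_plane I \<Longrightarrow> p (\<sigma> w) = w" "\<sigma> \<i> = base_point"
    and "continuous_on (slit_plane J) \<tau>" "\<tau> ` slit_plane J \<subseteq> U"
      "\<And>w. w \<in> slit_plane J \<Longrightarrow> p (\<tau> w) = w" "\<tau> \<i> = base_point"
  obtains g where "g \<in> deck" "\<And>w. Im w > 0 \<Longrightarrow> \<tau> w = \<sigma> w" "\<And>w. Im w < 0 \<Longrightarrow> \<tau> w = g (\<sigma> w)"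
    "W g = \<Lambda> (\<tau> (- \<i>)) - \<Lambda> (\<sigma> (- \<i>))"
proof -
  have i: "- \<i> \<in> slit_plane I" "- \<i> \<in> slit_plane J" by (auto simp: half_planes_in_slit_plane)
  then have U: "\<sigma> (- \<i>) \<in> U" "\<tau> (- \<i>) \<in> U" using assms(2,6) by auto
  \<comment> \<open>Prescribing \<open>g\<close> at \<open>- \<i>\<close> is enough: uniqueness of
    lifts spreads the relation over the connected lower half plane.\<close>
  obtain g where g: "g \<in> deck" "g (\<sigma> (- \<i>)) = \<tau> (- \<i>)"
    using deck_transitive[OF U] assms(3,7) i by metis
  have sub: "{w. Im w > 0} \<subseteq> slit_plane K" "{w. Im w < 0} \<subseteq> slit_plane K" for K
    by (auto simp: slit_plane_def)
  have conn: "connected {w. Im w > 0}" "connected {w. Im w < 0}"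
    by (auto intro: convex_connected convex_halfspace_Im_gt convex_halfspace_Im_lt)
  have 1: "\<tau> w = \<sigma> w" if "Im w > 0" for w
  proof (rule lift_unique[OF _ _ _ _ _ conn(1)])
    show "continuous_on {w. Im w > 0} \<tau>" "continuous_on {w. Im w > 0} \<sigma>"
      using assms(1,5) sub continuous_on_subset by blast+
    show "\<tau> ` {w. Im w > 0} \<subseteq> U" "\<sigma> ` {w. Im w > 0} \<subseteq> U"
      using assms(2,6) sub by blast+
    show "p (\<tau> t) = p (\<sigma> t)" if "t \<in> {w. 0 < Im w}" for t
      using that assms(3,7) sub by (metis subsetD)
    show "\<i> \<in> {w. 0 < Im w}" "w \<in> {w. 0 < Im w}" using that by auto
    show "\<tau> \<i> = \<sigma> \<i>" by (simp add: assms)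
  qed
  have 2: "\<tau> w = g (\<sigma> w)" if "Im w < 0" for w
  proof (rule lift_unique[OF _ _ _ _ _ conn(2)])
    show cont: "continuous_on {w. Im w < 0} \<tau>" using assms(5) sub continuous_on_subset by blast
    have sU: "\<sigma> ` {w. Im w < 0} \<subseteq> U" using assms(2) sub by blast
    have "continuous_on {w. Im w < 0} \<sigma>" using assms(1) sub continuous_on_subset by blast
    then show "continuous_on {w. Im w < 0} (\<lambda>w. g (\<sigma> w))"
      using sU by (rule continuous_on_compose2[OF deck_map(2)[OF g(1)]])
    show "\<tau> ` {w. Im w < 0} \<subseteq> U" using assms(6) sub by blast
    show "(\<lambda>w. g (\<sigma> w)) ` {w. Im w < 0} \<subseteq> U" using sU deck_map(5)[OF g(1)] by auto
    show "p (\<tau> t) = p (g (\<sigma> t))" if t: "t \<in> {w. Im w < 0}" for t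
    proof -
      have "\<sigma> t \<in> U" "t \<in> slit_plane I" "t \<in> slit_plane J" using sU sub t by blast+
      then show ?thesis using assms(3,7) deck_map(3)[OF g(1)] by simp
    qed
    show "- \<i> \<in> {w. Im w < 0}" "w \<in> {w. Im w < 0}" using that by auto
    show "\<tau> (- \<i>) = g (\<sigma> (- \<i>))" by (simp add: g)
  qed
  have "W g = \<Lambda> (\<tau> (- \<i>)) - \<Lambda> (\<sigma> (- \<i>))"
    using W_eq[OF g(1) U(1)] g(2) by simp
  then show ?thesis using that g 1 2 by blast
qed

text \<open>The three sections agree over the upper half plane. Going from \<open>\<i>\<close> to
  \<open>- \<i>\<close> through the negative axis and back through \<open>(0, 1)\<close> runs once
  counterclockwise around 0, which gives \<open>a\<close>; going through
  \<open>(1, \<infinity>)\<close> and back through \<open>(0, 1)\<close> runs once clockwise around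
  1, which gives \<open>b\<close>. All transitions between the sections lie in the group generated
  by \<open>a\<close> and \<open>b\<close>, so \<open>deck_eq_subgroup\<close> applies.\<close>

lemma deck_generators:
  obtains a b where "a \<in> deck" "b \<in> deck" "deck = generate (BijGroup U) {a, b}"
    "W a = (2 * pi * \<i>, 0)" "W b = (0, - (2 * pi * \<i>))"
proof -
  interpret B: group "BijGroup U" by (rule group_BijGroup)
  obtain \<sigma>0 where s0: "openin (top_of_set (- {0, 1})) (slit_plane {0<..<1})"
    "continuous_on (slit_plane {0<..<1}) \<sigma>0" "\<sigma>0 ` slit_plane {0<..<1} \<subseteq> U"
    "\<And>w. w \<in> slit_plane {0<..<1} \<Longrightarrow> p (\<sigma>0 w) = w" "\<sigma>0 \<i> = base_point"
    by (rule slit_section[of "{0<..<1}"]) auto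
  obtain \<sigma>1 where s1: "openin (top_of_set (- {0, 1})) (slit_plane {..<0})"
    "continuous_on (slit_plane {..<0}) \<sigma>1" "\<sigma>1 ` slit_plane {..<0} \<subseteq> U"
    "\<And>w. w \<in> slit_plane {..<0} \<Longrightarrow> p (\<sigma>1 w) = w" "\<sigma>1 \<i> = base_point"
    by (rule slit_section[of "{..<0}"]) auto
  obtain \<sigma>2 where s2: "openin (top_of_set (- {0, 1})) (slit_plane {1<..})"
    "continuous_on (slit_plane {1<..}) \<sigma>2" "\<sigma>2 ` slit_plane {1<..} \<subseteq> U"
    "\<And>w. w \<in> slit_plane {1<..} \<Longrightarrow> p (\<sigma>2 w) = w" "\<sigma>2 \<i> = base_point"
    by (rule slit_section[of "{1<..}"]) auto
  obtain a where a: "a \<in> deck" "\<And>w. Im w > 0 \<Longrightarrow> \<sigma>1 w = \<sigma>0 w" "\<And>w. Im w < 0 \<Longrightarrow> \<sigma>1 w = a (\<sigma>0 w)"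
    "W a = \<Lambda> (\<sigma>1 (- \<i>)) - \<Lambda> (\<sigma>0 (- \<i>))"
    by (rule compare_sections[OF s0(2-5) s1(2-5)]; (assumption | (rule that; assumption)))
  obtain b where b: "b \<in> deck" "\<And>w. Im w > 0 \<Longrightarrow> \<sigma>2 w = \<sigma>0 w" "\<And>w. Im w < 0 \<Longrightarrow> \<sigma>2 w = b (\<sigma>0 w)"
    "W b = \<Lambda> (\<sigma>2 (- \<i>)) - \<Lambda> (\<sigma>0 (- \<i>))"
    by (rule compare_sections[OF s0(2-5) s2(2-5)]; (assumption | (rule that; assumption)))
  have ne: "w \<noteq> 0 \<and> w \<noteq> 1" if "w \<in> slit_plane {0<..<1} \<or> w \<in> slit_plane {..<0} \<or> w \<in> slit_plane {1<..}" for w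
    using that by (auto simp: slit_plane_def)
  \<comment> \<open>On each slit plane the sign is chosen so that the argument of \<open>Ln\<close>
    avoids the nonpositive reals; these signs are the constants \<open>1\<close> and
    \<open>- 1\<close> passed to \<open>section_log_diff\<close>.\<close>
  have Ln: "continuous_on (slit_plane {0<..<1}) Ln" "continuous_on (slit_plane {1<..}) Ln"
    "continuous_on (slit_plane {..<0}) (\<lambda>w. Ln (- w))"
    "continuous_on (slit_plane {0<..<1}) (\<lambda>w. Ln (1 - w))"
    "continuous_on (slit_plane {..<0}) (\<lambda>w. Ln (1 - w))"
    "continuous_on (slit_plane {1<..}) (\<lambda>w. Ln (w - 1))"
    by (auto intro!: continuous_intros simp: slit_plane_def complex_nonpos_Reals_iff)
  have eq: "- \<i> - 1 = - (1 + \<i>)" "\<i> - 1 = - (1 - \<i>)" by auto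
  have Lni: "Ln (- \<i>) = Ln \<i> - pi * \<i>" by (simp add: Ln_minus_ii Ln_ii)
  \<comment> \<open>Expressing these values through \<open>Ln (1 + \<i>)\<close> and
    \<open>Ln (1 - \<i>)\<close> makes them comparable with the change along
    \<open>\<sigma>0\<close>; exactly one period remains.\<close>
  have Ln2: "Ln (- \<i> - 1) = Ln (1 + \<i>) - \<i> * pi" "Ln (\<i> - 1) = Ln (1 - \<i>) + \<i> * pi"
    unfolding eq by (subst Ln_minus; simp add: complex_eq_iff)+
  have "L0 (\<sigma>0 (- \<i>)) - L0 (\<sigma>0 \<i>) = Ln (- \<i>) - Ln \<i>"
    by (rule section_log_diff(1)[OF s0(2-4) _ _ Ln(1), of 1]) (use ne in auto)
  then have e1: "L0 (\<sigma>0 (- \<i>)) = L0 base_point - pi * \<i>"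
    by (simp add: s0(5) Lni algebra_simps)
  have "L1 (\<sigma>0 (- \<i>)) - L1 (\<sigma>0 \<i>) = Ln (1 - (- \<i>)) - Ln (1 - \<i>)"
    by (rule section_log_diff(2)[OF s0(2-4) _ _ Ln(4), of "- 1"]) (use ne in auto)
  then have e2: "L1 (\<sigma>0 (- \<i>)) = L1 base_point + Ln (1 + \<i>) - Ln (1 - \<i>)"
    by (simp add: s0(5) algebra_simps)
  have "L0 (\<sigma>1 (- \<i>)) - L0 (\<sigma>1 \<i>) = Ln (- (- \<i>)) - Ln (- \<i>)"
    by (rule section_log_diff(1)[OF s1(2-4) _ _ Ln(3), of "- 1"]) (use ne in auto)
  then have e3: "L0 (\<sigma>1 (- \<i>)) = L0 base_point + pi * \<i>"
    by (simp add: s1(5) Lni algebra_simps)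
  have "L1 (\<sigma>1 (- \<i>)) - L1 (\<sigma>1 \<i>) = Ln (1 - (- \<i>)) - Ln (1 - \<i>)"
    by (rule section_log_diff(2)[OF s1(2-4) _ _ Ln(5), of "- 1"]) (use ne in auto)
  then have e4: "L1 (\<sigma>1 (- \<i>)) = L1 base_point + Ln (1 + \<i>) - Ln (1 - \<i>)"
    by (simp add: s1(5) algebra_simps)
  have "L0 (\<sigma>2 (- \<i>)) - L0 (\<sigma>2 \<i>) = Ln (- \<i>) - Ln \<i>"
    by (rule section_log_diff(1)[OF s2(2-4) _ _ Ln(2), of 1]) (use ne in auto)
  then have e5: "L0 (\<sigma>2 (- \<i>)) = L0 base_point - pi * \<i>"
    by (simp add: s2(5) Lni algebra_simps)
  have "L1 (\<sigma>2 (- \<i>)) - L1 (\<sigma>2 \<i>) = Ln (- \<i> - 1) - Ln (\<i> - 1)"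
    by (rule section_log_diff(2)[OF s2(2-4) _ _ Ln(6), of 1]) (use ne in auto)
  then have e6: "L1 (\<sigma>2 (- \<i>)) = L1 base_point + Ln (1 + \<i>) - Ln (1 - \<i>) - 2 * pi * \<i>"
    by (simp add: s2(5) Ln2 algebra_simps)
  have "W a = (2 * pi * \<i>, 0)" "W b = (0, - (2 * pi * \<i>))"
    unfolding a(4) b(4) by (auto simp: \<Lambda>_def e1 e2 e3 e4 e5 e6)
  moreover have "generate (BijGroup U) {a, b} = deck"
  proof -
    let ?G = "generate (BijGroup U) {a, b}"
    have ab: "{a, b} \<subseteq> deck" using a b by auto
    have car: "deck \<subseteq> carrier (BijGroup U)" by (rule subgroup.subset[OF subgroup_deck])
    have sub: "?G \<subseteq> deck" by (rule B.generate_subgroup_incl[OF ab subgroup_deck])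
    have G: "subgroup ?G (BijGroup U)" using ab car by (intro B.generate_is_subgroup) blast
    have abG: "a \<in> ?G" "b \<in> ?G" by (auto intro: generate.incl)
    \<comment> \<open>The orbit relation of the generated group. Being an equivalence relation, it
      reduces the comparison of any two sections to their comparison with
      \<open>\<sigma>0\<close>.\<close>
    define R where "R x y \<longleftrightarrow> (\<exists>h\<in>?G. y = h x)" for x y
    have R_refl: "R x x" if "x \<in> U" for x
      unfolding R_def using generate.one[of "BijGroup U"] that
      by (intro bexI[of _ "\<one>\<^bsub>BijGroup U\<^esub>"]) (auto simp: BijGroup_def)
    have R_trans: "R x z" if "R x y" "R y z" "x \<in> U" for x y z
    proof -
      obtain h k where "h \<in> ?G" "y = h x" "k \<in> ?G" "z = k y" using \<open>R x y\<close> \<open>R y z\<close> by (auto simp: R_def)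
      then have "k \<otimes>\<^bsub>BijGroup U\<^esub> h \<in> ?G" "z = (k \<otimes>\<^bsub>BijGroup U\<^esub> h) x"
        using sub \<open>x \<in> U\<close> by (auto intro: generate.eng simp: deck_mult subset_iff)
      then show ?thesis unfolding R_def by blast
    qed
    have R_sym: "R y x" if "R x y" "x \<in> U" for x y
    proof -
      obtain h where h: "h \<in> ?G" "y = h x" using \<open>R x y\<close> by (auto simp: R_def)
      let ?h = "inv\<^bsub>BijGroup U\<^esub> h"
      have h': "?h \<in> ?G" by (rule subgroup.m_inv_closed[OF G h(1)])
      have "(?h \<otimes>\<^bsub>BijGroup U\<^esub> h) x = ?h (h x)"
        using h h' sub \<open>x \<in> U\<close> by (intro deck_mult) auto
      moreover have "?h \<otimes>\<^bsub>BijGroup U\<^esub> h = \<one>\<^bsub>BijGroup U\<^esub>"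
        using h sub car by (intro B.l_inv) auto
      ultimately have "x = ?h y" using h \<open>x \<in> U\<close> by (simp add: BijGroup_def)
      then show ?thesis unfolding R_def using h' by blast
    qed
    have R01: "R (\<sigma>0 w) (\<sigma>1 w)" if "Im w \<noteq> 0" for w
    proof -
      have "\<sigma>0 w \<in> U" using s0(3) that half_planes_in_slit_plane by blast
      then show ?thesis using R_refl a(2,3)[of w] abG that unfolding R_def
        by (metis linorder_neqE_linordered_idom)
    qed
    have R02: "R (\<sigma>0 w) (\<sigma>2 w)" if "Im w \<noteq> 0" for w
    proof -
      have "\<sigma>0 w \<in> U" using s0(3) that half_planes_in_slit_plane by blast
      then show ?thesis using R_refl b(2,3)[of w] abG that unfolding R_def
        by (metis linorder_neqE_linordered_idom)
    qed
    let ?S = "{(slit_plane {0<..<1}, \<sigma>0), (slit_plane {..<0}, \<sigma>1), (slit_plane {1<..}, \<sigma>2)}"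
    have S: "openin (top_of_set (- {0, 1})) V \<and> continuous_on V \<sigma> \<and> \<sigma> ` V \<subseteq> U \<and> (\<forall>w\<in>V. p (\<sigma> w) = w)"
      if "(V, \<sigma>) \<in> ?S" for V \<sigma>
      using that s0(1-4) s1(1-4) s2(1-4) by auto
    show ?thesis
    proof (rule deck_eq_subgroup[OF _ G sub S, of ?S])
      show "U \<noteq> {}" using base_point by auto
      show "\<exists>(V, \<sigma>)\<in>?S. w \<in> V" if "w \<in> - {0, 1}" for w :: complex
        using that by (auto simp: slit_plane_def complex_eq_iff)
      fix V \<sigma> V' \<sigma>' w
      assume VV: "(V, \<sigma>) \<in> ?S" "(V', \<sigma>') \<in> ?S" "w \<in> V \<inter> V'"
      have U: "\<sigma> w \<in> U" using S[OF VV(1)] VV(3) by auto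
      show "\<exists>h\<in>?G. \<sigma>' w = h (\<sigma> w)"
      proof (cases "Im w = 0")
        case True
        \<comment> \<open>The three gaps are disjoint, so a real point lies in only one of the slit
          planes.\<close>
        then have "\<sigma>' = \<sigma>" using VV by (auto simp: slit_plane_def)
        then show ?thesis using R_refl[OF U] by (simp add: R_def)
      next
        case False
        have in0: "\<sigma>0 w \<in> U" using s0(3) False half_planes_in_slit_plane by blast
        have "R (\<sigma>0 w) (\<sigma> w)" "R (\<sigma>0 w) (\<sigma>' w)"
          using VV R01[OF False] R02[OF False] R_refl[OF in0] by auto
        then have "R (\<sigma> w) (\<sigma>' w)" using R_trans R_sym in0 U by blast
        then show ?thesis by (simp add: R_def)
      qed
    qed auto
  qed
  ultimately show ?thesis using that a b by blast
qed

section \<open>The commutator subgroup as the kernel of the monodromy\<close>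

definition deck_group :: "('u \<Rightarrow> 'u) monoid" where
  "deck_group = BijGroup U \<lparr>carrier := deck\<rparr>"

lemma deck_group: "group deck_group" "carrier deck_group = deck"
    "mult deck_group = mult (BijGroup U)"
  using group.subgroup_imp_group[OF group_BijGroup subgroup_deck] by (auto simp: deck_group_def)

abbreviation "D \<equiv> derived (BijGroup U) deck"

text \<open>The group lemmas about additive maps speak of the whole carrier, while \<open>D\<close>
  is formed inside \<open>BijGroup U\<close>. Commutators and generated subgroups are computed alike
  in both groups.\<close>

lemma derived_deck_group: "derived deck_group (carrier deck_group) = D"
  using group.derived_consistent[OF group_BijGroup subset_refl subgroup_deck]
  by (simp add: deck_group_def)

lemma D_subset: "D \<subseteq> deck"
  by (rule group.derived_incl[OF group_BijGroup subset_refl subgroup_deck])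

lemma subgroup_D: "subgroup D (BijGroup U)"
  using group.derived_is_subgroup[OF group_BijGroup] subgroup.subset[OF subgroup_deck] .

lemma W_D: "d \<in> D \<Longrightarrow> W d = 0"
  using group.additive_derived[OF deck_group(1), of W d] derived_deck_group W_mult
  by (simp add: deck_group)

text \<open>The converse of \<open>W_D\<close>, and the reason for determining generators: their
  shifts are independent over the integers.\<close>

lemma W_kernel:
  assumes "g \<in> deck" "W g = 0"
  shows "g \<in> D"
proof -
  obtain a b where ab: "a \<in> deck" "b \<in> deck" "deck = generate (BijGroup U) {a, b}"
    "W a = (2 * pi * \<i>, 0)" "W b = (0, - (2 * pi * \<i>))"
    by (rule deck_generators)
  have gen: "carrier deck_group = generate deck_group {a, b}"
    using group.generate_consistent[OF group_BijGroup _ subgroup_deck, of "{a, b}"] ab(1-3)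
    by (simp add: deck_group_def)
  have "g \<in> derived deck_group (carrier deck_group)"
  proof (rule group.additive_kernel_derived[OF deck_group(1) _ _ _ gen, of W])
    show "m = 0 \<and> n = 0" if "of_int m *\<^sub>R W a + of_int n *\<^sub>R W b = 0" for m n
      using that by (simp add: ab zero_prod_def)
  qed (use assms ab W_mult in \<open>auto simp: deck_group\<close>)
  then show ?thesis by (simp only: derived_deck_group)
qed

lemma W_surj:
  obtains g where "g \<in> deck" "W g = (2 * of_int m * pi * \<i>, 2 * of_int n * pi * \<i>)"
proof -
  obtain a b where ab: "a \<in> deck" "b \<in> deck"
    "W a = (2 * pi * \<i>, 0)" "W b = (0, - (2 * pi * \<i>))"
    by (rule deck_generators)
  interpret G: group deck_group by (rule deck_group)
  have hom: "W (x \<otimes>\<^bsub>deck_group\<^esub> y) = W x + W y" if "x \<in> carrier deck_group" "y \<in> carrier deck_group" for x y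
    using that by (simp add: deck_group W_mult)
  \<comment> \<open>The exponent \<open>- n\<close> compensates the negative sign in
    \<open>W b\<close>.\<close>
  let ?g = "a [^]\<^bsub>deck_group\<^esub> m \<otimes>\<^bsub>deck_group\<^esub> b [^]\<^bsub>deck_group\<^esub> (- n)"
  have car: "a \<in> carrier deck_group" "b \<in> carrier deck_group" using ab by (auto simp: deck_group(2))
  have "?g \<in> carrier deck_group" using car by (intro G.m_closed G.int_pow_closed)
  moreover have "W ?g = of_int m *\<^sub>R W a + of_int (- n) *\<^sub>R W b"
    using car by (simp only: hom G.int_pow_closed G.additive_int_pow[of W, OF hom])
  then have "W ?g = (2 * of_int m * pi * \<i>, 2 * of_int n * pi * \<i>)"
    by (simp add: ab scaleR_conv_of_real)
  ultimately show ?thesis using that[of ?g] by (simp add: deck_group(2))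
qed

section \<open>Orbits of the commutator subgroup\<close>

lemma orbit_refl: "x \<in> U \<Longrightarrow> x \<in> ab_orbit U p x"
  unfolding ab_orbit_def using subgroup.one_closed[OF subgroup_D]
  by (intro image_eqI[of _ _ "\<one>\<^bsub>BijGroup U\<^esub>"]) (simp_all add: BijGroup_def)

lemma orbit_memD: "x \<in> U \<Longrightarrow> y \<in> ab_orbit U p x \<Longrightarrow> \<exists>g\<in>D. y = g x"
  by (auto simp: ab_orbit_def)

lemma orbit_shift:
  assumes "x \<in> U" "g \<in> D"
  shows "ab_orbit U p (g x) = ab_orbit U p x"
proof -
  interpret B: group "BijGroup U" by (rule group_BijGroup)
  let ?i = "inv\<^bsub>BijGroup U\<^esub> g"
  have sub: "d \<in> deck" if "d \<in> D" for d using that D_subset by blast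
  have gx: "g x \<in> U" using deck_map(5)[OF sub[OF assms(2)] assms(1)] .
  have i: "?i \<in> D" by (rule subgroup.m_inv_closed[OF subgroup_D assms(2)])
  have "?i (g x) = x"
  proof -
    have "?i (g x) = (?i \<otimes>\<^bsub>BijGroup U\<^esub> g) x"
      using assms i sub by (simp add: deck_mult)
    also have "?i \<otimes>\<^bsub>BijGroup U\<^esub> g = \<one>\<^bsub>BijGroup U\<^esub>"
      using subgroup.subset[OF subgroup_D] assms by (intro B.l_inv) auto
    finally show ?thesis using assms by (simp add: BijGroup_def)
  qed
  then have 1: "d x = (d \<otimes>\<^bsub>BijGroup U\<^esub> ?i) (g x)" if "d \<in> D" for d
    using that assms i sub gx by (simp add: deck_mult)
  have 2: "d (g x) = (d \<otimes>\<^bsub>BijGroup U\<^esub> g) x" if "d \<in> D" for d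
    using that assms i sub gx by (simp add: deck_mult)
  show ?thesis
  proof
    show "ab_orbit U p (g x) \<subseteq> ab_orbit U p x"
      using 2 subgroup.m_closed[OF subgroup_D _ assms(2)] by (auto simp: ab_orbit_def)
    show "ab_orbit U p x \<subseteq> ab_orbit U p (g x)"
      using 1 subgroup.m_closed[OF subgroup_D _ i] by (auto simp: ab_orbit_def)
  qed
qed

text \<open>Shows that functions constant on orbits descend through \<open>the_elem\<close>; applied
  to \<open>\<Lambda>\<close> for the map \<open>\<Phi>\<close> and to \<open>q\<close> for the
  projection \<open>ab_proj q\<close>.\<close>

lemma the_elem_orbit:
  assumes "x \<in> U" "\<And>g. g \<in> D \<Longrightarrow> h (g x) = h x"
  shows "the_elem (h ` ab_orbit U p x) = h x"
proof -
  have "h ` ab_orbit U p x = {h x}"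
    using assms orbit_refl[OF assms(1)] orbit_memD[OF assms(1)] by force
  then show ?thesis by simp
qed

text \<open>Commutators do not shift the logarithms. Conversely, points with equal logarithms lie in
  one fibre, so a deck transformation joins them; its shift is zero, and \<open>W_kernel\<close>
  places it in \<open>D\<close>.\<close>

lemma orbit_eq_iff:
  assumes "x \<in> U" "y \<in> U"
  shows "ab_orbit U p x = ab_orbit U p y \<longleftrightarrow> \<Lambda> x = \<Lambda> y"
proof
  assume "ab_orbit U p x = ab_orbit U p y"
  then obtain g where "g \<in> D" "y = g x"
    using orbit_refl[OF assms(2)] orbit_memD[OF assms(1)] by auto
  then show "\<Lambda> x = \<Lambda> y"
    using W_eq[of g x] W_D[of g] D_subset assms by auto
next
  assume eq: "\<Lambda> x = \<Lambda> y"
  obtain g where g: "g \<in> deck" "g x = y"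
    using deck_transitive[OF assms p_eq_if_\<Lambda>_eq[OF assms eq]] by blast
  then have "g \<in> D" using W_eq[OF g(1) assms(1)] eq by (intro W_kernel) auto
  then show "ab_orbit U p x = ab_orbit U p y" using orbit_shift[OF assms(1)] g by auto
qed

section \<open>The abelian cover as a closed curve\<close>

abbreviation "M \<equiv> universal_abelian_cover U p"

definition \<Phi> :: "'u set \<Rightarrow> complex \<times> complex" where
  "\<Phi> m = the_elem (\<Lambda> ` m)"

lemma topspace_M: "topspace M = ab_orbit U p ` U"
  by (simp add: universal_abelian_cover_def topspace_quotient_topology)

lemma quotient_map_orbit: "quotient_map (top_of_set U) M (ab_orbit U p)"
  unfolding universal_abelian_cover_def by (rule quotient_map_quotient_topology)

lemma \<Phi>_orbit: "x \<in> U \<Longrightarrow> \<Phi> (ab_orbit U p x) = \<Lambda> x"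
  unfolding \<Phi>_def using W_eq W_D D_subset by (intro the_elem_orbit) force+

lemma inj_\<Phi>: "inj_on \<Phi> (topspace M)"
  by (auto simp: inj_on_def topspace_M \<Phi>_orbit orbit_eq_iff)

lemma continuous_\<Phi>: "continuous_map M euclidean \<Phi>"
proof (rule continuous_compose_quotient_map[OF quotient_map_orbit])
  have "continuous_map (top_of_set U) euclidean \<Lambda>" using continuous_\<Lambda> by simp
  then show "continuous_map (top_of_set U) euclidean (\<Phi> \<circ> ab_orbit U p)"
    by (rule continuous_map_eq) (simp add: \<Phi>_orbit)
qed

text \<open>For surjectivity choose a point over \<open>exp a\<close>. Its two logarithms differ
  from \<open>a\<close> and \<open>b\<close> by independent integer multiples of the period, and
  \<open>W_surj\<close> provides a deck transformation that corrects both at once.\<close>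

lemma image_\<Lambda>: "\<Lambda> ` U = log_curve"
proof
  show "\<Lambda> ` U \<subseteq> log_curve" using \<Lambda>_in_curve by blast
  show "log_curve \<subseteq> \<Lambda> ` U"
  proof
    fix v assume "v \<in> log_curve"
    then obtain a b where v: "v = (a, b)" "exp a - exp b = 1" by (auto simp: log_curve_def)
    have "exp a \<noteq> 1"
    proof
      assume "exp a = 1"
      with v(2) have "exp b = 0" by simp
      then show False by simp
    qed
    then have "exp a \<in> p ` U" using covering_space_imp_surjective[OF cov] by simp
    then obtain x where x: "x \<in> U" "p x = exp a" by auto
    have "exp a = exp (L0 x)" using L0(2) x by simp
    then obtain m :: int where m: "a = L0 x + of_real (2 * of_int m * pi) * \<i>" by (auto simp: exp_eq)
    have "exp b = exp a - 1" using v(2) by (simp add: algebra_simps)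
    then have "exp b = exp (L1 x)" using L1(2) x by simp
    then obtain n :: int where n: "b = L1 x + of_real (2 * of_int n * pi) * \<i>" by (auto simp: exp_eq)
    obtain g where g: "g \<in> deck" "W g = (2 * of_int m * pi * \<i>, 2 * of_int n * pi * \<i>)" by (rule W_surj)
    have "\<Lambda> (g x) = \<Lambda> x + W g" using W_eq[OF g(1) x(1)] by (metis add.commute diff_add_cancel)
    also have "\<dots> = v" by (simp add: g(2) v(1) m n \<Lambda>_def)
    finally show "v \<in> \<Lambda> ` U" using deck_map(5)[OF g(1) x(1)] by (metis imageI)
  qed
qed

text \<open>Near \<open>y\<close> the candidate preimage of \<open>(a, b)\<close> is
  \<open>\<sigma> (exp a)\<close>. On the curve its logarithms have the right exponentials, so the
  error \<open>r\<close> consists of periods; it vanishes at \<open>y\<close> and is therefore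
  small, hence zero, on the neighbourhood \<open>N\<close>.\<close>

lemma open_map_\<Lambda>:
  assumes "openin (top_of_set U) S"
  shows "openin (top_of_set log_curve) (\<Lambda> ` S)"
proof (subst openin_subopen, intro ballI)
  fix y assume "y \<in> \<Lambda> ` S"
  then obtain x where x: "x \<in> S" "y = \<Lambda> x" by auto
  then have xU: "x \<in> U" using openin_subset[OF assms] by auto
  obtain V \<sigma> where V: "openin (top_of_set (- {0, 1})) V" "p x \<in> V" "continuous_on V \<sigma>" "\<sigma> ` V \<subseteq> U"
    "\<sigma> (p x) = x" "\<And>w. w \<in> V \<Longrightarrow> p (\<sigma> w) = w"
    using local_section[OF xU] by blast
  have V_open: "open V" using V(1) open_base by (simp add: openin_open_eq)
  define V' where "V' = V \<inter> \<sigma> -` S"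
  have "openin (top_of_set V) V'"
    unfolding V'_def using V assms by (intro continuous_openin_preimage[of _ _ U]) auto
  then have V'_open: "open V'" using V_open by (simp add: openin_open_eq)
  define A where "A = {v :: complex \<times> complex. exp (fst v) \<in> V'}"
  have "open (((\<lambda>v::complex \<times> complex. exp (fst v))) -` V')"
    using V'_open by (intro open_vimage continuous_intros)
  then have A_open: "open A" by (simp add: A_def vimage_def)
  define r where "r v = \<Lambda> (\<sigma> (exp (fst v))) - v" for v
  have "continuous_on A (\<lambda>v. \<Lambda> (\<sigma> (exp (fst v))))"
    using V by (intro continuous_on_compose2[OF continuous_\<Lambda>] continuous_on_compose2[OF V(3)] continuous_intros)
      (auto simp: A_def V'_def)
  then have r_cont: "continuous_on A r" unfolding r_def by (intro continuous_intros)
  define N where "N = A \<inter> r -` ball 0 pi"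
  have N_open: "open N" unfolding N_def using A_open r_cont by (intro continuous_open_preimage) auto
  have "log_curve \<inter> N \<subseteq> \<Lambda> ` S"
  proof
    fix v assume v: "v \<in> log_curve \<inter> N"
    obtain a b where ab: "v = (a, b)" by (cases v)
    let ?x = "\<sigma> (exp a)"
    have aV: "exp a \<in> V" "?x \<in> S" "norm (\<Lambda> ?x - v) < pi"
      using v by (auto simp: N_def A_def V'_def ab r_def)
    then have "?x \<in> U" "p ?x = exp a" using V by auto
    have "norm (L0 ?x - a) < pi" "norm (L1 ?x - b) < pi"
      using aV(3) norm_fst_le[of "L0 ?x - a" "L1 ?x - b"] norm_snd_le[of "L1 ?x - b" "L0 ?x - a"]
      unfolding ab \<Lambda>_def by auto
    \<comment> \<open>Imaginary parts closer than \<open>2 * pi\<close> exclude a nonzero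
      period.\<close>
    then have Im: "\<bar>Im (L0 ?x) - Im a\<bar> < 2 * pi" "\<bar>Im (L1 ?x) - Im b\<bar> < 2 * pi"
      using abs_Im_le_cmod[of "L0 ?x - a"] abs_Im_le_cmod[of "L1 ?x - b"] pi_gt_zero by auto
    have "exp (L0 ?x) = exp a" "exp (L1 ?x) = exp b"
      using L0(2)[OF \<open>?x \<in> U\<close>] L1(2)[OF \<open>?x \<in> U\<close>] \<open>p ?x = exp a\<close> v
      by (auto simp: ab log_curve_def algebra_simps)
    then have "\<Lambda> ?x = v" using Im by (auto simp: \<Lambda>_def ab intro: exp_complex_eqI)
    then show "v \<in> \<Lambda> ` S" using aV(2) by blast
  qed
  moreover have "y \<in> log_curve \<inter> N"
  proof -
    have "exp (fst (\<Lambda> x)) = p x" using L0(2)[OF xU] by (simp add: \<Lambda>_def)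
    then show ?thesis
      using x V \<Lambda>_in_curve[OF xU] by (auto simp: N_def A_def V'_def r_def)
  qed
  moreover have "openin (top_of_set log_curve) (log_curve \<inter> N)" using N_open by blast
  ultimately show "\<exists>T. openin (top_of_set log_curve) T \<and> y \<in> T \<and> T \<subseteq> \<Lambda> ` S" by blast
qed

lemma homeomorphic_map_\<Phi>: "homeomorphic_map M (top_of_set log_curve) \<Phi>"
proof (rule bijective_open_imp_homeomorphic_map)
  have im: "\<Phi> ` topspace M = log_curve"
    by (simp add: topspace_M image_image \<Phi>_orbit image_\<Lambda> cong: image_cong)
  then show "\<Phi> ` topspace M = topspace (top_of_set log_curve)" by simp
  show "continuous_map M (top_of_set log_curve) \<Phi>"
    using continuous_\<Phi> im by (auto simp: continuous_map_in_subtopology)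
  show "open_map M (top_of_set log_curve) \<Phi>"
    unfolding open_map_def
  proof (intro allI impI)
    fix V assume V: "openin M V"
    then have op: "openin (top_of_set U) {x \<in> U. ab_orbit U p x \<in> V}"
      by (simp add: universal_abelian_cover_def openin_quotient_topology)
    have "V \<subseteq> ab_orbit U p ` U" using openin_subset[OF V] by (simp add: topspace_M)
    then have "\<Phi> ` V = \<Lambda> ` {x \<in> U. ab_orbit U p x \<in> V}"
      by (force simp: \<Phi>_orbit)
    then show "openin (top_of_set log_curve) (\<Phi> ` V)" using open_map_\<Lambda>[OF op] by simp
  qed
qed (rule inj_\<Phi>)

end

section \<open>An affine coordinate with punctures 0, 1 and infinity\<close>

lemma \<zeta>_cube: "\<zeta> ^ 3 = 1"
proof -
  have "\<zeta> ^ 3 = exp (of_nat 3 * (2 * pi * \<i> / 3))" unfolding \<zeta>_def by (rule exp_of_nat_mult[symmetric])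
  also have "of_nat 3 * (2 * pi * \<i> / 3) = 2 * of_real pi * \<i>" by simp
  finally show ?thesis by (simp only: exp_two_pi_i)
qed

lemma \<zeta>_neq_1: "\<zeta> \<noteq> 1"
proof
  assume "\<zeta> = 1"
  then obtain n :: int where "2 * pi / 3 = of_int (2 * n) * pi"
    unfolding \<zeta>_def exp_eq_1 by auto
  then have "of_int (6 * n) = (2::real)" by (simp add: field_simps)
  then have "6 * n = 2" by linarith
  then show False by presburger
qed

lemma \<zeta>_neq_0: "\<zeta> \<noteq> 0" by (simp add: \<zeta>_def)

lemma \<zeta>_square: "\<zeta>\<^sup>2 = - 1 - \<zeta>"
proof -
  have "(\<zeta> - 1) * (\<zeta>\<^sup>2 + \<zeta> + 1) = 0"
    using \<zeta>_cube by (simp add: algebra_simps power2_eq_square power3_eq_cube)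
  then have "\<zeta>\<^sup>2 + \<zeta> + 1 = 0" using \<zeta>_neq_1 by simp
  then show ?thesis by (simp add: algebra_simps eq_neg_iff_add_eq_0)
qed

text \<open>Rewrite rules that bring polynomials in \<open>\<zeta>\<close> to degree at most one;
  the second catches the right-nested products that \<open>algebra_simps\<close> creates.\<close>

lemma \<zeta>_mult: "\<zeta> * \<zeta> = - 1 - \<zeta>" "\<zeta> * (\<zeta> * z) = (- 1 - \<zeta>) * z"
  using \<zeta>_square by (simp_all add: power2_eq_square flip: mult.assoc)

lemma cube_minus_one_factor: "z ^ 3 - 1 = (z - 1) * (z - \<zeta>) * (z - \<zeta>\<^sup>2)"
  unfolding \<zeta>_square by (simp add: algebra_simps \<zeta>_mult power3_eq_cube)

lemma \<zeta>_distinct: "\<zeta> \<noteq> \<zeta>\<^sup>2" "\<zeta>\<^sup>2 \<noteq> 1"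
proof -
  show "\<zeta> \<noteq> \<zeta>\<^sup>2" using \<zeta>_neq_0 \<zeta>_neq_1 by (simp add: power2_eq_square)
  show "\<zeta>\<^sup>2 \<noteq> 1"
  proof
    assume "\<zeta>\<^sup>2 = 1"
    then show False using \<zeta>_cube \<zeta>_neq_1 by (simp add: power3_eq_cube power2_eq_square)
  qed
qed

section \<open>Homogeneous coordinates and the Moebius transformation\<close>

lemma span_scale_complex:
  fixes v :: "complex^2"
  assumes "c \<noteq> 0"
  shows "vec.span {c *s v} = vec.span {v}"
  using assms vec.span_image_scale[of "{v}" "\<lambda>_. c"] by simp

lemma line_eq_iff:
  fixes u v :: "complex^2"
  assumes "u \<noteq> 0" "v \<noteq> 0"
  shows "line u = line v \<longleftrightarrow> u $ 1 * v $ 2 = u $ 2 * v $ 1"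
proof
  assume "line u = line v"
  then have "vec.span {u} = vec.span {v}" using Rep_line assms by metis
  then have "u \<in> vec.span {v}" using vec.span_base[of u "{u}"] by auto
  then obtain c where "u = c *s v" by (auto simp: vec.span_singleton)
  then show "u $ 1 * v $ 2 = u $ 2 * v $ 1" by simp
next
  assume eq: "u $ 1 * v $ 2 = u $ 2 * v $ 1"
  have "\<exists>c. c \<noteq> 0 \<and> u = c *s v"
  proof (cases "v $ 1 = 0")
    case True
    then have "v $ 2 \<noteq> 0" using assms by (auto simp: vec_eq_iff forall_2)
    then have "u $ 1 = 0" using eq True by simp
    then have "u $ 2 \<noteq> 0" using assms by (auto simp: vec_eq_iff forall_2)
    then show ?thesis using \<open>v $ 2 \<noteq> 0\<close> \<open>u $ 1 = 0\<close> True
      by (intro exI[of _ "u $ 2 / v $ 2"]) (auto simp: vec_eq_iff forall_2)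
  next
    case False
    have "u $ 1 \<noteq> 0"
    proof
      assume "u $ 1 = 0"
      then show False using eq False assms by (auto simp: vec_eq_iff forall_2)
    qed
    then show ?thesis using False eq
      by (intro exI[of _ "u $ 1 / v $ 1"]) (auto simp: vec_eq_iff forall_2 field_simps)
  qed
  then show "line u = line v" by (auto simp: line_def span_scale_complex)
qed

lemma line_exhaust:
  obtains v :: "complex^2" where "v \<noteq> 0" "L = line v"
proof -
  have L: "vec.subspace (Rep_cp1 L)" "vec.dim (Rep_cp1 L) = 1" using Rep_cp1[of L] by auto
  obtain B where B: "B \<subseteq> Rep_cp1 L" "vec.independent B" "Rep_cp1 L \<subseteq> vec.span B" "card B = vec.dim (Rep_cp1 L)"
    using vec.basis_exists by blast
  obtain v where v: "B = {v}" using B(4) L(2) by (metis card_1_singletonE)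
  have "v \<noteq> 0" using B(2) v vec.dependent_zero by blast
  moreover have "Rep_cp1 L = vec.span {v}"
    using B v L(1) by (metis vec.span_minimal subset_antisym)
  then have "L = line v" by (metis Rep_cp1_inverse line_def)
  ultimately show ?thesis by (rule that)
qed

lemma chart_vectors_nonzero [simp]: "vector [z, 1] \<noteq> (0 :: complex^2)" "vector [1, z] \<noteq> (0 :: complex^2)"
  by (auto simp: vec_eq_iff forall_2)

lemma line_in_punctured_iff:
  assumes "v \<noteq> 0"
  shows "line v \<in> punctured_cp1 \<longleftrightarrow> v $ 1 \<noteq> v $ 2 \<and> v $ 1 \<noteq> \<zeta> * v $ 2 \<and> v $ 1 \<noteq> \<zeta>\<^sup>2 * v $ 2"
  using assms by (auto simp: punctured_cp1_def aff_def line_eq_iff mult.commute)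

text \<open>The Moebius transformation \<open>z \<mapsto> (\<zeta> - \<zeta> z) / (z - \<zeta>\<^sup>2)\<close> takes \<open>1, \<zeta>, \<zeta>\<^sup>2\<close> to \<open>0, 1, \<infinity>\<close>.\<close>

definition mob :: "cp1 \<Rightarrow> complex" where
  "mob L = (let v = SOME v. v \<noteq> 0 \<and> L = line v in (\<zeta> * v $ 2 - \<zeta> * v $ 1) / (v $ 1 - \<zeta>\<^sup>2 * v $ 2))"

text \<open>Obtained by solving \<open>w * (z - \<zeta>\<^sup>2) = \<zeta> - \<zeta> * z\<close> for
  \<open>z\<close>. Homogeneous coordinates also cover \<open>w = - \<zeta>\<close>, which
  corresponds to the point at infinity.\<close>

definition mob_inv :: "complex \<Rightarrow> cp1" where
  "mob_inv w = line (vector [\<zeta>\<^sup>2 * w + \<zeta>, w + \<zeta>])"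

text \<open>Numerator and denominator are homogeneous of degree one, so the representative chosen by
  \<open>SOME\<close> does not matter.\<close>

lemma mob_line:
  assumes "v \<noteq> 0"
  shows "mob (line v) = (\<zeta> * v $ 2 - \<zeta> * v $ 1) / (v $ 1 - \<zeta>\<^sup>2 * v $ 2)"
proof -
  define u where "u = (SOME u. u \<noteq> 0 \<and> line v = line u)"
  have u: "u \<noteq> 0" "line v = line u"
    using someI[of "\<lambda>u. u \<noteq> 0 \<and> line v = line u" v] assms by (auto simp: u_def)
  have "(\<zeta> * u $ 2 - \<zeta> * u $ 1) / (u $ 1 - \<zeta>\<^sup>2 * u $ 2) = (\<zeta> * v $ 2 - \<zeta> * v $ 1) / (v $ 1 - \<zeta>\<^sup>2 * v $ 2)"
  proof -
    have "u \<in> vec.span {v}" using u assms Rep_line by (metis insertI1 vec.span_base)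
    then obtain c where c: "u = c *s v" by (auto simp: vec.span_singleton)
    then have "c \<noteq> 0" using u by auto
    have "(\<zeta> * u $ 2 - \<zeta> * u $ 1) = c * (\<zeta> * v $ 2 - \<zeta> * v $ 1)"
      "u $ 1 - \<zeta>\<^sup>2 * u $ 2 = c * (v $ 1 - \<zeta>\<^sup>2 * v $ 2)"
      by (simp_all add: c algebra_simps)
    then show ?thesis using \<open>c \<noteq> 0\<close> by simp
  qed
  then show ?thesis by (simp add: mob_def Let_def flip: u_def)
qed

lemma mob_vec_nonzero: "vector [\<zeta>\<^sup>2 * w + \<zeta>, w + \<zeta>] \<noteq> (0 :: complex^2)"
proof
  assume "vector [\<zeta>\<^sup>2 * w + \<zeta>, w + \<zeta>] = (0 :: complex^2)"
  then have "\<zeta>\<^sup>2 * w + \<zeta> = 0" "w + \<zeta> = 0" by (auto simp: vec_eq_iff forall_2)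
  then have w: "w = - \<zeta>" by (simp add: eq_neg_iff_add_eq_0)
  have "\<zeta>\<^sup>2 * w = - (\<zeta> ^ 3)" by (simp add: w power2_eq_square power3_eq_cube)
  then have "\<zeta> = 1" using \<open>\<zeta>\<^sup>2 * w + \<zeta> = 0\<close> \<zeta>_cube by (simp add: add_eq_0_iff2)
  then show False using \<zeta>_neq_1 by simp
qed

lemma mob_minus_1:
  assumes "v \<noteq> 0" "line v \<in> punctured_cp1"
  shows "mob (line v) - 1 = \<zeta>\<^sup>2 * (v $ 1 - \<zeta> * v $ 2) / (v $ 1 - \<zeta>\<^sup>2 * v $ 2)"
proof -
  have "v $ 1 - \<zeta>\<^sup>2 * v $ 2 \<noteq> 0" using assms by (simp add: line_in_punctured_iff)
  then show ?thesis using assms(1)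
    by (simp add: mob_line field_simps) (simp add: \<zeta>_square \<zeta>_mult algebra_simps)
qed

lemma mob_in: "L \<in> punctured_cp1 \<Longrightarrow> mob L \<in> - {0, 1}"
proof -
  assume L: "L \<in> punctured_cp1"
  obtain v :: "complex^2" where v: "v \<noteq> 0" "L = line v" by (rule line_exhaust)
  then have n: "v $ 1 \<noteq> v $ 2" "v $ 1 \<noteq> \<zeta> * v $ 2" "v $ 1 \<noteq> \<zeta>\<^sup>2 * v $ 2" using L by (auto simp: line_in_punctured_iff)
  have "mob L \<noteq> 0" using n v \<zeta>_neq_0 by (simp add: mob_line)
  moreover have "mob L - 1 \<noteq> 0" using n v L \<zeta>_neq_0 by (simp add: mob_minus_1)
  ultimately show ?thesis by auto
qed

lemma mob_inv_mob:
  assumes "L \<in> punctured_cp1"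
  shows "mob_inv (mob L) = L"
proof -
  obtain v :: "complex^2" where v: "v \<noteq> 0" "L = line v" by (rule line_exhaust)
  then have n: "v $ 1 - \<zeta>\<^sup>2 * v $ 2 \<noteq> 0" using assms by (auto simp: line_in_punctured_iff)
  have mob: "mob L * (v $ 1 - \<zeta>\<^sup>2 * v $ 2) = \<zeta> * v $ 2 - \<zeta> * v $ 1"
    using n v by (simp add: mob_line)
  \<comment> \<open>Up to the nonzero denominator of \<open>mob L\<close>, the vector defining
    \<open>mob_inv (mob L)\<close> is \<open>(\<zeta> - 1)\<close> times \<open>v\<close>, so it
    spans the same line.\<close>
  have eq: "(\<zeta>\<^sup>2 * mob L + \<zeta>) * (v $ 1 - \<zeta>\<^sup>2 * v $ 2) = (\<zeta> - 1) * v $ 1"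
    "(mob L + \<zeta>) * (v $ 1 - \<zeta>\<^sup>2 * v $ 2) = (\<zeta> - 1) * v $ 2"
    unfolding distrib_right mult.assoc mob by (simp_all add: \<zeta>_square \<zeta>_mult algebra_simps)
  have "((\<zeta>\<^sup>2 * mob L + \<zeta>) * v $ 2) * (v $ 1 - \<zeta>\<^sup>2 * v $ 2)
      = ((\<zeta>\<^sup>2 * mob L + \<zeta>) * (v $ 1 - \<zeta>\<^sup>2 * v $ 2)) * v $ 2"
    by (simp only: mult_ac)
  also have "\<dots> = ((mob L + \<zeta>) * (v $ 1 - \<zeta>\<^sup>2 * v $ 2)) * v $ 1"
    unfolding eq by (simp only: mult_ac)
  also have "\<dots> = ((mob L + \<zeta>) * v $ 1) * (v $ 1 - \<zeta>\<^sup>2 * v $ 2)"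
    by (simp only: mult_ac)
  finally have "(\<zeta>\<^sup>2 * mob L + \<zeta>) * v $ 2 = (mob L + \<zeta>) * v $ 1"
    by (rule mult_right_cancel[THEN iffD1, OF n])
  then show ?thesis using n v mob_vec_nonzero[of "mob L"]
    unfolding mob_inv_def by (simp add: line_eq_iff)
qed

lemma mob_mob_inv:
  assumes "w \<in> - {0, 1}"
  shows "mob_inv w \<in> punctured_cp1" "mob (mob_inv w) = w"
proof -
  have d: "\<zeta>\<^sup>2 * w + \<zeta> - \<zeta>\<^sup>2 * (w + \<zeta>) = \<zeta> - 1"
    "\<zeta>\<^sup>2 * w + \<zeta> - (w + \<zeta>) = (\<zeta>\<^sup>2 - 1) * w"
    "\<zeta>\<^sup>2 * w + \<zeta> - \<zeta> * (w + \<zeta>) = (\<zeta>\<^sup>2 - \<zeta>) * (w - 1)"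
    by (simp_all add: \<zeta>_square \<zeta>_mult algebra_simps)
  have n: "(\<zeta>\<^sup>2 - 1) * w \<noteq> 0" "\<zeta> - 1 \<noteq> 0" "(\<zeta>\<^sup>2 - \<zeta>) * (w - 1) \<noteq> 0"
    using \<zeta>_distinct \<zeta>_neq_1 assms by auto
  have n': "\<zeta>\<^sup>2 * w + \<zeta> - \<zeta>\<^sup>2 * (w + \<zeta>) \<noteq> 0" "\<zeta>\<^sup>2 * w + \<zeta> - (w + \<zeta>) \<noteq> 0"
    "\<zeta>\<^sup>2 * w + \<zeta> - \<zeta> * (w + \<zeta>) \<noteq> 0"
    unfolding d using n by auto
  then show "mob_inv w \<in> punctured_cp1"
    unfolding mob_inv_def line_in_punctured_iff[OF mob_vec_nonzero] vector_2 right_minus_eq by blast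
  have "(\<zeta> * (w + \<zeta>) - \<zeta> * (\<zeta>\<^sup>2 * w + \<zeta>)) = w * (\<zeta> - 1)"
    by (simp add: \<zeta>_square \<zeta>_mult algebra_simps)
  then show "mob (mob_inv w) = w"
    unfolding mob_inv_def mob_line[OF mob_vec_nonzero] vector_2 d(1) using n by simp
qed

section \<open>Continuity of the coordinate and transport of the covering\<close>

lemma open_cp1_iff: "open S \<longleftrightarrow> open {v :: complex^2. v \<noteq> 0 \<and> line v \<in> S}" for S :: "cp1 set"
  by (simp add: open_cp1_def)

lemma open_punctured_cp1: "open punctured_cp1"
proof -
  have "{v :: complex^2. v \<noteq> 0 \<and> line v \<in> punctured_cp1}
      = - {0} \<inter> {v. v $ 1 \<noteq> v $ 2} \<inter> {v. v $ 1 \<noteq> \<zeta> * v $ 2} \<inter> {v. v $ 1 \<noteq> \<zeta>\<^sup>2 * v $ 2}"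
    by (auto simp: line_in_punctured_iff)
  moreover have "open \<dots>"
    by (intro open_Int open_Collect_neq continuous_intros open_Compl)
  ultimately show ?thesis by (simp add: open_cp1_iff)
qed

text \<open>By the quotient topology a set of lines is tested on the nonzero vectors that span them,
  and there \<open>mob\<close> is a quotient of linear forms.\<close>

lemma continuous_mob: "continuous_on punctured_cp1 mob"
  unfolding continuous_on_open_vimage[OF open_punctured_cp1]
proof (intro allI impI)
  fix B :: "complex set" assume B: "open B"
  let ?E = "{v :: complex^2. v \<noteq> 0 \<and> line v \<in> punctured_cp1}"
  let ?f = "\<lambda>v :: complex^2. (\<zeta> * v $ 2 - \<zeta> * v $ 1) / (v $ 1 - \<zeta>\<^sup>2 * v $ 2)"
  have "open ?E" using open_punctured_cp1 by (simp only: open_cp1_iff)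
  moreover have "continuous_on ?E ?f"
    by (intro continuous_intros) (auto simp: line_in_punctured_iff)
  ultimately have "open (?E \<inter> ?f -` B)" using B by (intro continuous_open_preimage)
  moreover have "{v :: complex^2. v \<noteq> 0 \<and> line v \<in> mob -` B \<inter> punctured_cp1} = ?E \<inter> ?f -` B"
    by (auto simp: mob_line)
  ultimately show "open (mob -` B \<inter> punctured_cp1)" by (simp add: open_cp1_iff)
qed

lemma continuous_mob_inv: "continuous_on UNIV mob_inv"
  unfolding continuous_on_open_vimage[OF open_UNIV]
proof (intro allI impI)
  fix B :: "cp1 set" assume "open B"
  then have B: "open {v :: complex^2. v \<noteq> 0 \<and> line v \<in> B}" by (simp only: open_cp1_iff)
  have "continuous_on UNIV (\<lambda>w. vector [\<zeta>\<^sup>2 * w + \<zeta>, w + \<zeta>] :: complex^2)"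
  proof -
    have "(\<lambda>w. vector [\<zeta>\<^sup>2 * w + \<zeta>, w + \<zeta>] :: complex^2)
        = (\<lambda>w. \<chi> i. if i = 1 then \<zeta>\<^sup>2 * w + \<zeta> else w + \<zeta>)"
      by (simp add: fun_eq_iff vec_eq_iff forall_2)
    moreover have "continuous_on UNIV (\<lambda>w. (\<chi> i. if i = 1 then \<zeta>\<^sup>2 * w + \<zeta> else w + \<zeta>) :: complex^2)"
    proof (rule continuous_on_vec_lambda)
      show "continuous_on UNIV (\<lambda>w. if i = 1 then \<zeta>\<^sup>2 * w + \<zeta> else w + \<zeta>)" for i :: 2
        by (cases "i = 1") (auto intro!: continuous_intros)
    qed
    ultimately show ?thesis by (simp only:)
  qed
  then have "open ((\<lambda>w. vector [\<zeta>\<^sup>2 * w + \<zeta>, w + \<zeta>] :: complex^2) -` {v. v \<noteq> 0 \<and> line v \<in> B})"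
    using B by (intro open_vimage)
  also have "(\<lambda>w. vector [\<zeta>\<^sup>2 * w + \<zeta>, w + \<zeta>] :: complex^2) -` {v. v \<noteq> 0 \<and> line v \<in> B} = mob_inv -` B"
    using mob_vec_nonzero by (auto simp: mob_inv_def)
  finally show "open (mob_inv -` B \<inter> UNIV)" by simp
qed

lemma homeomorphism_mob: "homeomorphism punctured_cp1 (- {0, 1}) mob mob_inv"
  unfolding homeomorphism_def
  using mob_in mob_inv_mob mob_mob_inv continuous_mob continuous_on_subset[OF continuous_mob_inv]
  by (auto simp: image_iff; metis ComplI insert_iff singletonD)

lemma covering_space_compose_homeomorphism:
  assumes cov: "covering_space C q X" and hom: "homeomorphism X Y h k"
  shows "covering_space C (h \<circ> q) Y"
  unfolding covering_space_def
proof (intro conjI ballI)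
  have q: "continuous_on C q" "q ` C = X" using covering_space_imp_continuous[OF cov] covering_space_imp_surjective[OF cov] by auto
  have h: "continuous_on X h" "h ` X = Y" "continuous_on Y k" "k ` Y = X"
    "\<And>x. x \<in> X \<Longrightarrow> k (h x) = x" "\<And>y. y \<in> Y \<Longrightarrow> h (k y) = y"
    using hom by (auto simp: homeomorphism_def)
  show "continuous_on C (h \<circ> q)" using q h unfolding o_def by (intro continuous_on_compose2[OF h(1) q(1)]) auto
  show "(h \<circ> q) ` C = Y" using q h by (metis image_comp)
  fix y assume y: "y \<in> Y"
  then have "k y \<in> X" using h by auto
  then obtain T VS where T: "k y \<in> T" "openin (top_of_set X) T" "\<Union>VS = C \<inter> q -` T"
    "\<forall>u\<in>VS. openin (top_of_set C) u" "pairwise disjnt VS" "\<forall>u\<in>VS. \<exists>r. homeomorphism u T q r"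
    using cov unfolding covering_space_def by blast
  have TX: "T \<subseteq> X" using openin_subset[OF T(2)] by simp
  have a1: "openin (top_of_set Y) (h ` T)"
    using homeomorphism_imp_open_map[OF hom T(2)] .
  have a2: "y \<in> h ` T" using T(1) h(6)[OF y] by (metis imageI)
  have a3: "\<Union>VS = C \<inter> (h \<circ> q) -` (h ` T)"
  proof -
    have eq: "h (q x) \<in> h ` T \<longleftrightarrow> q x \<in> T" if "x \<in> C" for x
    proof
      assume "h (q x) \<in> h ` T"
      then obtain t where t: "t \<in> T" "h (q x) = h t" by (rule imageE)
      have X: "q x \<in> X" "t \<in> X" using that q(2) t(1) TX by auto
      have "q x = k (h (q x))" by (rule h(5)[OF X(1), symmetric])
      also have "\<dots> = t" unfolding t(2) by (rule h(5)[OF X(2)])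
      finally show "q x \<in> T" using t(1) by (rule ssubst)
    qed (rule imageI)
    have "x \<in> C \<inter> q -` T \<longleftrightarrow> x \<in> C \<inter> (h \<circ> q) -` h ` T" for x
      using eq[of x] by (simp only: Int_iff vimage_eq o_apply) blast
    then show ?thesis unfolding T(3) by (rule Set.set_eqI)
  qed
  have a4: "\<exists>r. homeomorphism u (h ` T) (h \<circ> q) r" if u: "u \<in> VS" for u
  proof -
    obtain r where r: "homeomorphism u T q r" using bspec[OF T(6) u] by blast
    have "homeomorphism T (h ` T) h k"
      by (rule homeomorphism_of_subsets[OF hom TX order_refl refl])
    from homeomorphism_compose[OF r this] show ?thesis by blast
  qed
  show "\<exists>T. y \<in> T \<and> openin (top_of_set Y) T \<and> (\<exists>v. \<Union>v = C \<inter> (h \<circ> q) -` T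
      \<and> (\<forall>u\<in>v. openin (top_of_set C) u) \<and> pairwise disjnt v \<and> (\<forall>u\<in>v. \<exists>r. homeomorphism u T (h \<circ> q) r))"
    using T(4) by (intro exI[of _ "h ` T"] exI[of _ VS] conjI ballI a1 a2 a3 a4 T(5)) simp
qed

section \<open>The two charts\<close>

lemma aff_in_punctured_iff: "aff z \<in> punctured_cp1 \<longleftrightarrow> z \<noteq> 1 \<and> z \<noteq> \<zeta> \<and> z \<noteq> \<zeta>\<^sup>2"
  by (simp add: aff_def line_in_punctured_iff)

lemma aff_inf_in_punctured_iff:
  "aff_inf w \<in> punctured_cp1 \<longleftrightarrow> 1 - w \<noteq> 0 \<and> 1 - \<zeta> * w \<noteq> 0 \<and> 1 - \<zeta>\<^sup>2 * w \<noteq> 0"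
  by (auto simp: aff_inf_def line_in_punctured_iff)

lemma mob_aff: "mob (aff z) = (\<zeta> - \<zeta> * z) / (z - \<zeta>\<^sup>2)"
  by (simp add: aff_def mob_line)

lemma mob_aff_inf: "mob (aff_inf w) = (\<zeta> * w - \<zeta>) / (1 - \<zeta>\<^sup>2 * w)"
  by (simp add: aff_inf_def mob_line)

lemma mob_aff_minus_1: "aff z \<in> punctured_cp1 \<Longrightarrow> mob (aff z) - 1 = \<zeta>\<^sup>2 * (z - \<zeta>) / (z - \<zeta>\<^sup>2)"
  using mob_minus_1[of "vector [z, 1]"] by (simp add: aff_def)

lemma mob_aff_inf_minus_1:
  "aff_inf w \<in> punctured_cp1 \<Longrightarrow> mob (aff_inf w) - 1 = \<zeta>\<^sup>2 * (1 - \<zeta> * w) / (1 - \<zeta>\<^sup>2 * w)"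
  using mob_minus_1[of "vector [1, w]"] by (simp add: aff_inf_def)

text \<open>The logarithmic derivatives of \<open>w\<close> and \<open>w - 1\<close> with respect to
  \<open>z\<close>.\<close>

definition dlog_aff :: "complex \<Rightarrow> complex \<times> complex" where
  "dlog_aff z = (1 / (z - 1) - 1 / (z - \<zeta>\<^sup>2), 1 / (z - \<zeta>) - 1 / (z - \<zeta>\<^sup>2))"

definition dlog_aff_inf :: "complex \<Rightarrow> complex \<times> complex" where
  "dlog_aff_inf w = (\<zeta>\<^sup>2 / (1 - \<zeta>\<^sup>2 * w) - 1 / (1 - w), \<zeta>\<^sup>2 / (1 - \<zeta>\<^sup>2 * w) - \<zeta> / (1 - \<zeta> * w))"

text \<open>Both sides of the second equation are the derivative of \<open>w\<close>, expressed
  through \<open>log w\<close> and through \<open>log (w - 1)\<close>. The third conclusion is what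
  the immersion property rests on.\<close>

lemma mob_aff_deriv:
  assumes "aff z \<in> punctured_cp1"
  shows "((\<lambda>z. mob (aff z)) has_field_derivative mob (aff z) * fst (dlog_aff z)) (at z)"
    "mob (aff z) * fst (dlog_aff z) = (mob (aff z) - 1) * snd (dlog_aff z)"
    "fst (dlog_aff z) \<noteq> 0"
proof -
  have n: "z \<noteq> 1" "z \<noteq> \<zeta>" "z \<noteq> \<zeta>\<^sup>2" using assms by (auto simp: aff_in_punctured_iff)
  then have n': "z - 1 \<noteq> 0" "z - \<zeta> \<noteq> 0" "z - \<zeta>\<^sup>2 \<noteq> 0" by auto
  have f: "fst (dlog_aff z) = (1 - \<zeta>\<^sup>2) / ((z - 1) * (z - \<zeta>\<^sup>2))"
    using n' by (simp add: dlog_aff_def diff_frac_eq)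
  have s: "snd (dlog_aff z) = (\<zeta> - \<zeta>\<^sup>2) / ((z - \<zeta>) * (z - \<zeta>\<^sup>2))"
    using n' by (simp add: dlog_aff_def diff_frac_eq)
  show "fst (dlog_aff z) \<noteq> 0" using f n' \<zeta>_distinct by simp
  have 1: "mob (aff z) * fst (dlog_aff z) = - \<zeta> * (1 - \<zeta>\<^sup>2) / (z - \<zeta>\<^sup>2)\<^sup>2"
  proof -
    have "mob (aff z) = - \<zeta> * (z - 1) / (z - \<zeta>\<^sup>2)" by (simp add: mob_aff algebra_simps)
    then show ?thesis using n' by (simp add: f power2_eq_square)
  qed
  have 2: "(mob (aff z) - 1) * snd (dlog_aff z) = \<zeta>\<^sup>2 * (\<zeta> - \<zeta>\<^sup>2) / (z - \<zeta>\<^sup>2)\<^sup>2"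
    using n' by (simp add: mob_aff_minus_1[OF assms] s power2_eq_square)
  have "- \<zeta> * (1 - \<zeta>\<^sup>2) = \<zeta>\<^sup>2 * (\<zeta> - \<zeta>\<^sup>2)"
    by (simp add: \<zeta>_square \<zeta>_mult algebra_simps)
  then show "mob (aff z) * fst (dlog_aff z) = (mob (aff z) - 1) * snd (dlog_aff z)"
    by (simp only: 1 2)
  have "((\<lambda>z. (\<zeta> - \<zeta> * z) / (z - \<zeta>\<^sup>2)) has_field_derivative
      ((- \<zeta>) * (z - \<zeta>\<^sup>2) - (\<zeta> - \<zeta> * z) * 1) / ((z - \<zeta>\<^sup>2) * (z - \<zeta>\<^sup>2))) (at z)"
    using n' by (auto intro!: derivative_eq_intros)
  moreover have "((- \<zeta>) * (z - \<zeta>\<^sup>2) - (\<zeta> - \<zeta> * z) * 1) = - \<zeta> * (1 - \<zeta>\<^sup>2)"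
    by (simp add: algebra_simps)
  ultimately show "((\<lambda>z. mob (aff z)) has_field_derivative mob (aff z) * fst (dlog_aff z)) (at z)"
    unfolding 1 unfolding mob_aff by (simp add: power2_eq_square)
qed

lemma mob_aff_inf_deriv:
  assumes "aff_inf z \<in> punctured_cp1"
  shows "((\<lambda>z. mob (aff_inf z)) has_field_derivative mob (aff_inf z) * fst (dlog_aff_inf z)) (at z)"
    "mob (aff_inf z) * fst (dlog_aff_inf z) = (mob (aff_inf z) - 1) * snd (dlog_aff_inf z)"
    "fst (dlog_aff_inf z) \<noteq> 0"
proof -
  have n: "1 - z \<noteq> 0" "1 - \<zeta> * z \<noteq> 0" "1 - \<zeta>\<^sup>2 * z \<noteq> 0" using assms[unfolded aff_inf_in_punctured_iff] by blast+
  have f: "fst (dlog_aff_inf z) = (\<zeta>\<^sup>2 - 1) / ((1 - z) * (1 - \<zeta>\<^sup>2 * z))"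
    using n by (simp add: dlog_aff_inf_def diff_frac_eq) (simp add: algebra_simps)
  have s: "snd (dlog_aff_inf z) = (\<zeta>\<^sup>2 - \<zeta>) / ((1 - \<zeta> * z) * (1 - \<zeta>\<^sup>2 * z))"
    using n by (simp add: dlog_aff_inf_def diff_frac_eq) (simp add: algebra_simps)
  show "fst (dlog_aff_inf z) \<noteq> 0" using f n \<zeta>_distinct by simp
  have 1: "mob (aff_inf z) * fst (dlog_aff_inf z) = - \<zeta> * (\<zeta>\<^sup>2 - 1) / (1 - \<zeta>\<^sup>2 * z)\<^sup>2"
  proof -
    have "mob (aff_inf z) = - \<zeta> * (1 - z) / (1 - \<zeta>\<^sup>2 * z)" by (simp add: mob_aff_inf algebra_simps)
    then show ?thesis using n by (simp add: f power2_eq_square)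
  qed
  have 2: "(mob (aff_inf z) - 1) * snd (dlog_aff_inf z) = \<zeta>\<^sup>2 * (\<zeta>\<^sup>2 - \<zeta>) / (1 - \<zeta>\<^sup>2 * z)\<^sup>2"
    using n by (simp add: mob_aff_inf_minus_1[OF assms] s power2_eq_square)
  have "- \<zeta> * (\<zeta>\<^sup>2 - 1) = \<zeta>\<^sup>2 * (\<zeta>\<^sup>2 - \<zeta>)"
    by (simp add: \<zeta>_square \<zeta>_mult algebra_simps)
  then show "mob (aff_inf z) * fst (dlog_aff_inf z) = (mob (aff_inf z) - 1) * snd (dlog_aff_inf z)"
    by (simp only: 1 2)
  have "((\<lambda>z. (\<zeta> * z - \<zeta>) / (1 - \<zeta>\<^sup>2 * z)) has_field_derivative
      (\<zeta> * (1 - \<zeta>\<^sup>2 * z) - (\<zeta> * z - \<zeta>) * (- \<zeta>\<^sup>2)) / ((1 - \<zeta>\<^sup>2 * z) * (1 - \<zeta>\<^sup>2 * z))) (at z)"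
    using n by (auto intro!: derivative_eq_intros)
  moreover have "\<zeta> * (1 - \<zeta>\<^sup>2 * z) - (\<zeta> * z - \<zeta>) * (- \<zeta>\<^sup>2) = - \<zeta> * (\<zeta>\<^sup>2 - 1)"
    by (simp add: algebra_simps)
  ultimately show "((\<lambda>z. mob (aff_inf z)) has_field_derivative mob (aff_inf z) * fst (dlog_aff_inf z)) (at z)"
    unfolding 1 unfolding mob_aff_inf by (simp add: power2_eq_square)
qed

text \<open>Near \<open>z\<close> a continuous logarithm of \<open>h\<close> must coincide with
  \<open>l z + Ln (h t / h z)\<close>, whose derivative is the logarithmic derivative of
  \<open>h\<close>.\<close>

lemma has_field_derivative_log:
  fixes l h :: "complex \<Rightarrow> complex"
  assumes N: "open N" "z \<in> N" and l: "continuous_on N l" "\<And>t. t \<in> N \<Longrightarrow> exp (l t) = h t"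
    and h: "(h has_field_derivative h z * d) (at z)"
  shows "(l has_field_derivative d) (at z)"
proof -
  have hz: "h z \<noteq> 0" using l(2)[OF N(2)] by (metis exp_not_eq_zero)
  \<comment> \<open>The radius \<open>pi\<close> keeps \<open>l t - l z\<close> in the strip on
    which \<open>Ln\<close> inverts \<open>exp\<close>.\<close>
  define N' where "N' = N \<inter> l -` ball (l z) pi"
  have N': "open N'" "z \<in> N'"
    unfolding N'_def using N l by (auto intro: continuous_open_preimage)
  have "((\<lambda>t. l z + Ln (h t / h z)) has_field_derivative 0 + (1 / (h z / h z)) * (h z * d / h z)) (at z)"
    using h hz by (auto intro!: derivative_eq_intros)
  then have "((\<lambda>t. l z + Ln (h t / h z)) has_field_derivative d) (at z)" using hz by simp
  then show ?thesis
  proof (rule has_field_derivative_transform_within_open[OF _ N'])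
    fix t assume t: "t \<in> N'"
    then have "cmod (l z - l t) < pi" by (simp add: N'_def dist_norm)
    then have "\<bar>Im (l t - l z)\<bar> < pi" using abs_Im_le_cmod[of "l t - l z"] by (simp add: norm_minus_commute)
    then have "Ln (exp (l t - l z)) = l t - l z" by (intro Ln_exp) auto
    moreover have "exp (l t - l z) = h t / h z"
      using t N(2) l(2) by (simp add: N'_def exp_diff)
    ultimately show "l z + Ln (h t / h z) = l t" by simp
  qed
qed

text \<open>Collects the facts about a coordinate that the arguments on the cover use, so that
  \<open>aff\<close> and \<open>aff_inf\<close> are treated together.\<close>

definition chart :: "(complex \<Rightarrow> cp1) \<Rightarrow> (complex \<Rightarrow> complex \<times> complex) \<Rightarrow> bool" where
  "chart \<phi> d \<longleftrightarrow> open {t. \<phi> t \<in> punctured_cp1} \<and> (\<forall>z. \<phi> z \<in> punctured_cp1 \<longrightarrow>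
     ((\<lambda>t. mob (\<phi> t)) has_field_derivative mob (\<phi> z) * fst (d z)) (at z) \<and>
     mob (\<phi> z) * fst (d z) = (mob (\<phi> z) - 1) * snd (d z) \<and> fst (d z) \<noteq> 0)"

lemma chart_aff: "chart aff dlog_aff"
proof -
  have "{t. aff t \<in> punctured_cp1} = - {1, \<zeta>, \<zeta>\<^sup>2}" by (auto simp: aff_in_punctured_iff)
  moreover have "open (- {1, \<zeta>, \<zeta>\<^sup>2})" by (intro open_Compl finite_imp_closed) auto
  ultimately have "open {t. aff t \<in> punctured_cp1}" by (simp only:)
  then show ?thesis unfolding chart_def using mob_aff_deriv by blast
qed

lemma chart_aff_inf: "chart aff_inf dlog_aff_inf"
proof -
  have "{t. aff_inf t \<in> punctured_cp1} = {t. 1 - t \<noteq> 0} \<inter> {t. 1 - \<zeta> * t \<noteq> 0} \<inter> {t. 1 - \<zeta>\<^sup>2 * t \<noteq> 0}"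
    unfolding aff_inf_in_punctured_iff by blast
  moreover have "open \<dots>" by (intro open_Int open_Collect_neq continuous_intros)
  ultimately have "open {t. aff_inf t \<in> punctured_cp1}" by (simp only:)
  then show ?thesis unfolding chart_def using mob_aff_inf_deriv by blast
qed

lemma cp1_chart_cases:
  obtains z where "L = aff z" | w where "L = aff_inf w"
proof -
  obtain v :: "complex^2" where v: "v \<noteq> 0" "L = line v" by (rule line_exhaust)
  show ?thesis
  proof (cases "v $ 2 = 0")
    case True
    then have "L = aff_inf 0" using v by (simp add: aff_inf_def line_eq_iff)
    then show ?thesis by (rule that(2))
  next
    case False
    then have "L = aff (v $ 1 / v $ 2)" using v by (simp add: aff_def line_eq_iff)
    then show ?thesis by (rule that(1))
  qed
qed

text \<open>Differentials are given in the coordinates \<open>aff\<close> and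
  \<open>aff_inf\<close>, local sections in terms of \<open>w\<close>; this is the holomorphic
  change between them. At \<open>w = - \<zeta>\<close>, the point at infinity,
  \<open>aff_inf\<close> takes over.\<close>

lemma mob_inv_in_chart:
  obtains \<phi> k N where "\<phi> \<in> {aff, aff_inf}" "open N" "w \<in> N" "k holomorphic_on N"
    "\<And>t. t \<in> N \<Longrightarrow> \<phi> (k t) = mob_inv t"
proof (cases "w + \<zeta> = 0")
  case False
  show ?thesis
  proof (rule that[of aff "{t. t + \<zeta> \<noteq> 0}" "\<lambda>t. (\<zeta>\<^sup>2 * t + \<zeta>) / (t + \<zeta>)"])
    show "open {t. t + \<zeta> \<noteq> 0}" by (intro open_Collect_neq continuous_intros)
    show "(\<lambda>t. (\<zeta>\<^sup>2 * t + \<zeta>) / (t + \<zeta>)) holomorphic_on {t. t + \<zeta> \<noteq> 0}"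
      by (intro holomorphic_intros) auto
    show "aff ((\<zeta>\<^sup>2 * t + \<zeta>) / (t + \<zeta>)) = mob_inv t" if "t \<in> {t. t + \<zeta> \<noteq> 0}" for t
      using that unfolding aff_def mob_inv_def line_eq_iff[OF chart_vectors_nonzero(1) mob_vec_nonzero]
      by simp
  qed (use False in auto)
next
  case True
  have nz: "\<zeta>\<^sup>2 * w + \<zeta> \<noteq> 0"
  proof
    assume "\<zeta>\<^sup>2 * w + \<zeta> = 0"
    then have "vector [\<zeta>\<^sup>2 * w + \<zeta>, w + \<zeta>] = (0 :: complex^2)"
      using True by (simp add: vec_eq_iff forall_2)
    then show False using mob_vec_nonzero by blast
  qed
  show ?thesis
  proof (rule that[of aff_inf "{t. \<zeta>\<^sup>2 * t + \<zeta> \<noteq> 0}" "\<lambda>t. (t + \<zeta>) / (\<zeta>\<^sup>2 * t + \<zeta>)"])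
    show "open {t. \<zeta>\<^sup>2 * t + \<zeta> \<noteq> 0}" by (intro open_Collect_neq continuous_intros)
    show "(\<lambda>t. (t + \<zeta>) / (\<zeta>\<^sup>2 * t + \<zeta>)) holomorphic_on {t. \<zeta>\<^sup>2 * t + \<zeta> \<noteq> 0}"
      by (intro holomorphic_intros) auto
    show "aff_inf ((t + \<zeta>) / (\<zeta>\<^sup>2 * t + \<zeta>)) = mob_inv t" if "t \<in> {t. \<zeta>\<^sup>2 * t + \<zeta> \<noteq> 0}" for t
      using that unfolding aff_inf_def mob_inv_def line_eq_iff[OF chart_vectors_nonzero(2) mob_vec_nonzero]
      by simp
  qed (use nz in auto)
qed

section \<open>The Scherk form in logarithmic coordinates\<close>

text \<open>With the logarithms of \<open>w\<close> and \<open>w - 1\<close> inserted,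
  \<open>A\<close> and \<open>B\<close> are primitives of \<open>z dz / (z ^ 3 - 1)\<close> and
  \<open>dz / (z ^ 3 - 1)\<close>. The coefficients are the residues at 1 and
  \<open>\<zeta>\<close>, namely 1/3 and \<open>\<zeta>\<^sup>2 / 3\<close> for \<open>A\<close>,
  1/3 and \<open>\<zeta> / 3\<close> for \<open>B\<close>; the residue at
  \<open>\<zeta>\<^sup>2\<close> is minus their sum.\<close>

definition scherk_map :: "complex \<times> complex \<Rightarrow> complex^2" where
  "scherk_map v = (let A = (fst v + \<zeta>\<^sup>2 * snd v) / 3; B = (fst v + \<zeta> * snd v) / 3 in
     complex_of_real (sqrt (3 / 2)) *s
       vector [exp (- (pi * \<i> / 3)) * A + exp (pi * \<i> / 6) * cnj B,
               - exp (pi * \<i> / 3) * B - exp (- (pi * \<i> / 6)) * cnj A])"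

lemma linear_scherk_map: "linear scherk_map"
  by (rule linearI)
    (simp_all add: scherk_map_def Let_def vec_eq_iff forall_2,
     simp_all add: scaleR_conv_of_real field_simps)

text \<open>On the kernel the two components give \<open>cnj B = \<i> * A\<close> and
  \<open>cnj A = - \<i> * B\<close>, and together these yield \<open>A = - A\<close>. Then
  \<open>A = B = 0\<close> determines \<open>v\<close> because \<open>\<zeta>\<close> and
  \<open>\<zeta>\<^sup>2\<close> are distinct.\<close>

lemma inj_scherk_map: "inj scherk_map"
  unfolding linear_injective_0[OF linear_scherk_map]
proof (intro allI impI)
  fix v assume 0: "scherk_map v = 0"
  define A B where "A = (fst v + \<zeta>\<^sup>2 * snd v) / 3" and "B = (fst v + \<zeta> * snd v) / 3"
  \<comment> \<open>The phases within each component differ by a quarter turn; factoring one out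
    leaves only the factor \<open>\<i>\<close> or \<open>- \<i>\<close>.\<close>
  have e1: "exp (- (pi * \<i> / 3)) = exp (pi * \<i> / 6) * (- \<i>)"
  proof -
    have "exp (- (pi * \<i> / 3)) = exp (pi * \<i> / 6) * exp (\<i> * (- (pi / 2)))"
      unfolding exp_add[symmetric] by (rule arg_cong[of _ _ exp]) (simp add: field_simps)
    also have "exp (\<i> * (- (pi / 2))) = cis (- (pi / 2))" by (simp only: cis_conv_exp of_real_minus)
    finally show ?thesis by (simp only: cis_minus_pi_half)
  qed
  have e2: "exp (pi * \<i> / 3) = exp (- (pi * \<i> / 6)) * \<i>"
  proof -
    have "exp (pi * \<i> / 3) = exp (- (pi * \<i> / 6)) * exp (\<i> * (pi / 2))"
      unfolding exp_add[symmetric] by (rule arg_cong[of _ _ exp]) (simp add: field_simps)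
    also have "exp (\<i> * (pi / 2)) = cis (pi / 2)" by (simp only: cis_conv_exp)
    finally show ?thesis by (simp only: cis_pi_half)
  qed
  from 0 have "exp (- (pi * \<i> / 3)) * A + exp (pi * \<i> / 6) * cnj B = 0"
    "- exp (pi * \<i> / 3) * B - exp (- (pi * \<i> / 6)) * cnj A = 0"
    unfolding A_def B_def by (simp_all add: scherk_map_def Let_def vec_eq_iff forall_2)
  moreover have "exp (pi * \<i> / 6) * (cnj B - \<i> * A) = exp (- (pi * \<i> / 3)) * A + exp (pi * \<i> / 6) * cnj B"
    unfolding e1 by (simp add: algebra_simps)
  moreover have "exp (- (pi * \<i> / 6)) * (cnj A + \<i> * B)
      = - (- exp (pi * \<i> / 3) * B - exp (- (pi * \<i> / 6)) * cnj A)"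
    unfolding e2 by (simp add: algebra_simps)
  ultimately have "exp (pi * \<i> / 6) * (cnj B - \<i> * A) = 0" "exp (- (pi * \<i> / 6)) * (cnj A + \<i> * B) = 0"
    by (simp_all only: minus_zero)
  then have B: "cnj B = \<i> * A" and A: "cnj A = - \<i> * B"
    by (simp_all add: eq_neg_iff_add_eq_0)
  have "A = cnj (cnj A)" by simp
  also have "\<dots> = \<i> * cnj B" unfolding A by simp
  also have "\<dots> = - A" unfolding B by simp
  finally have "A = 0" by simp
  then have "B = 0" using B by simp
  from \<open>A = 0\<close> \<open>B = 0\<close> have ab: "fst v + \<zeta>\<^sup>2 * snd v = 0" "fst v + \<zeta> * snd v = 0"
    by (simp_all add: A_def B_def)
  have "(\<zeta>\<^sup>2 - \<zeta>) * snd v = (fst v + \<zeta>\<^sup>2 * snd v) - (fst v + \<zeta> * snd v)"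
    by (simp add: algebra_simps)
  then have "(\<zeta>\<^sup>2 - \<zeta>) * snd v = 0" unfolding ab by simp
  then have "snd v = 0" using \<zeta>_distinct by auto
  then show "v = 0" using ab by (simp add: prod_eq_iff)
qed

lemma dlog_aff_form:
  assumes "aff z \<in> punctured_cp1"
  shows "(fst (dlog_aff z) + \<zeta>\<^sup>2 * snd (dlog_aff z)) / 3 = z / (z ^ 3 - 1)"
    "(fst (dlog_aff z) + \<zeta> * snd (dlog_aff z)) / 3 = 1 / (z ^ 3 - 1)"
proof -
  have n: "z - 1 \<noteq> 0" "z - \<zeta> \<noteq> 0" "z - \<zeta>\<^sup>2 \<noteq> 0" using assms by (auto simp: aff_in_punctured_iff)
  have P: "z ^ 3 - 1 \<noteq> 0" using n by (simp add: cube_minus_one_factor)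
  have f: "fst (dlog_aff z) * (z ^ 3 - 1) = (1 - \<zeta>\<^sup>2) * (z - \<zeta>)"
    unfolding cube_minus_one_factor using n by (simp add: dlog_aff_def diff_frac_eq)
  have s: "snd (dlog_aff z) * (z ^ 3 - 1) = (\<zeta> - \<zeta>\<^sup>2) * (z - 1)"
    unfolding cube_minus_one_factor using n by (simp add: dlog_aff_def diff_frac_eq)
  have "(fst (dlog_aff z) + \<zeta>\<^sup>2 * snd (dlog_aff z)) * (z ^ 3 - 1) = 3 * z"
    unfolding distrib_right mult.assoc f s by (simp add: \<zeta>_square \<zeta>_mult algebra_simps)
  then show "(fst (dlog_aff z) + \<zeta>\<^sup>2 * snd (dlog_aff z)) / 3 = z / (z ^ 3 - 1)"
    using P by (simp add: divide_simps mult_ac)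
  have "(fst (dlog_aff z) + \<zeta> * snd (dlog_aff z)) * (z ^ 3 - 1) = 3"
    unfolding distrib_right mult.assoc f s by (simp add: \<zeta>_square \<zeta>_mult algebra_simps)
  then show "(fst (dlog_aff z) + \<zeta> * snd (dlog_aff z)) / 3 = 1 / (z ^ 3 - 1)"
    using P by (simp add: divide_simps mult_ac)
qed

lemma dlog_aff_inf_form:
  assumes "aff_inf w \<in> punctured_cp1"
  shows "(fst (dlog_aff_inf w) + \<zeta>\<^sup>2 * snd (dlog_aff_inf w)) / 3 = - 1 / (1 - w ^ 3)"
    "(fst (dlog_aff_inf w) + \<zeta> * snd (dlog_aff_inf w)) / 3 = - w / (1 - w ^ 3)"
proof -
  have n: "1 - w \<noteq> 0" "1 - \<zeta> * w \<noteq> 0" "1 - \<zeta>\<^sup>2 * w \<noteq> 0"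
    using assms[unfolded aff_inf_in_punctured_iff] by blast+
  have third: "(- 3 * c / P) / 3 = - c / P" for c P :: complex by simp
  have fac: "1 - w ^ 3 = (1 - w) * (1 - \<zeta> * w) * (1 - \<zeta>\<^sup>2 * w)"
    unfolding \<zeta>_square by (simp add: algebra_simps \<zeta>_mult power3_eq_cube)
  have P: "1 - w ^ 3 \<noteq> 0" unfolding fac using n by simp
  have f: "fst (dlog_aff_inf w) * (1 - w ^ 3) = (\<zeta>\<^sup>2 - 1) * (1 - \<zeta> * w)"
  proof -
    have "fst (dlog_aff_inf w) = (\<zeta>\<^sup>2 - 1) / ((1 - w) * (1 - \<zeta>\<^sup>2 * w))"
      using n by (simp add: dlog_aff_inf_def diff_frac_eq) (simp add: algebra_simps)
    then show ?thesis unfolding fac using n by simp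
  qed
  have s: "snd (dlog_aff_inf w) * (1 - w ^ 3) = (\<zeta>\<^sup>2 - \<zeta>) * (1 - w)"
  proof -
    have "snd (dlog_aff_inf w) = (\<zeta>\<^sup>2 - \<zeta>) / ((1 - \<zeta> * w) * (1 - \<zeta>\<^sup>2 * w))"
      using n by (simp add: dlog_aff_inf_def diff_frac_eq) (simp add: algebra_simps)
    then show ?thesis unfolding fac using n by simp
  qed
  have "(fst (dlog_aff_inf w) + \<zeta>\<^sup>2 * snd (dlog_aff_inf w)) * (1 - w ^ 3) = - 3"
    unfolding distrib_right mult.assoc f s by (simp add: \<zeta>_square \<zeta>_mult algebra_simps)
  then have "fst (dlog_aff_inf w) + \<zeta>\<^sup>2 * snd (dlog_aff_inf w) = - 3 / (1 - w ^ 3)"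
    by (rule iffD2[OF nonzero_eq_divide_eq[OF P]])
  then show "(fst (dlog_aff_inf w) + \<zeta>\<^sup>2 * snd (dlog_aff_inf w)) / 3 = - 1 / (1 - w ^ 3)"
    by (simp only: third[of 1, unfolded mult_1_right])
  have "(fst (dlog_aff_inf w) + \<zeta> * snd (dlog_aff_inf w)) * (1 - w ^ 3) = - 3 * w"
    unfolding distrib_right mult.assoc f s by (simp add: \<zeta>_square \<zeta>_mult algebra_simps)
  then have "fst (dlog_aff_inf w) + \<zeta> * snd (dlog_aff_inf w) = - 3 * w / (1 - w ^ 3)"
    by (rule iffD2[OF nonzero_eq_divide_eq[OF P]])
  then show "(fst (dlog_aff_inf w) + \<zeta> * snd (dlog_aff_inf w)) / 3 = - w / (1 - w ^ 3)"
    by (simp only: third)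
qed

lemma factor_third: "(a * h + e * (b * h)) / 3 = (a + e * b) / 3 * h" for a b e h :: complex
  by (simp add: field_simps)

lemma scherk_form_eq_scherk_map:
  assumes "aff z \<in> punctured_cp1"
  shows "scherk_form z h = scherk_map (fst (dlog_aff z) * h, snd (dlog_aff z) * h)"
proof -
  have A: "(fst (dlog_aff z) * h + \<zeta>\<^sup>2 * (snd (dlog_aff z) * h)) / 3 = z * (h / (z ^ 3 - 1))"
    unfolding factor_third dlog_aff_form(1)[OF assms] by simp
  have B: "(fst (dlog_aff z) * h + \<zeta> * (snd (dlog_aff z) * h)) / 3 = h / (z ^ 3 - 1)"
    unfolding factor_third dlog_aff_form(2)[OF assms] by simp
  show ?thesis
    unfolding scherk_map_def fst_conv snd_conv A B Let_def scherk_form_def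
    by (simp add: vec_eq_iff forall_2) (simp add: algebra_simps)
qed

lemma scherk_form_inf_eq_scherk_map:
  assumes "aff_inf w \<in> punctured_cp1"
  shows "scherk_form_inf w h = scherk_map (fst (dlog_aff_inf w) * h, snd (dlog_aff_inf w) * h)"
proof -
  have A: "(fst (dlog_aff_inf w) * h + \<zeta>\<^sup>2 * (snd (dlog_aff_inf w) * h)) / 3 = - h / (1 - w ^ 3)"
    unfolding factor_third dlog_aff_inf_form(1)[OF assms] by simp
  have B: "(fst (dlog_aff_inf w) * h + \<zeta> * (snd (dlog_aff_inf w) * h)) / 3 = w * (- h / (1 - w ^ 3))"
    unfolding factor_third dlog_aff_inf_form(2)[OF assms] by simp
  show ?thesis
    unfolding scherk_map_def fst_conv snd_conv A B Let_def scherk_form_inf_def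
    by (simp add: vec_eq_iff forall_2) (simp add: algebra_simps)
qed

section \<open>The Scherk surface on the universal abelian cover\<close>

locale universal_abelian_covering =
  fixes U :: "'u::real_normed_vector set" and q :: "'u \<Rightarrow> cp1"
  assumes ucov: "universal_covering U q punctured_cp1"

sublocale universal_abelian_covering \<subseteq> twice_punctured_covering U "mob \<circ> q"
  using ucov covering_space_compose_homeomorphism[OF _ homeomorphism_mob]
  by unfold_locales (auto simp: universal_covering_def)

context universal_abelian_covering
begin

section \<open>Transfer from the twice punctured plane\<close>

lemma q_in: "x \<in> U \<Longrightarrow> q x \<in> punctured_cp1"
  using ucov covering_space_imp_surjective by (force simp: universal_covering_def)

text \<open>\<open>mob\<close> is injective on the punctured line, so \<open>q\<close> and
  \<open>mob \<circ> q\<close> have the same fibres. Hence all results about the orbits and the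
  cover for \<open>mob \<circ> q\<close> hold for \<open>q\<close>.\<close>

lemma deck_transformations_mob: "deck_transformations U (mob \<circ> q) = deck_transformations U q"
proof -
  have "mob (q (g x)) = mob (q x) \<longleftrightarrow> q (g x) = q x" if "g \<in> Bij U" "x \<in> U" for g x
  proof -
    have "g x \<in> U" using that Bij_imp_funcset by blast
    then show ?thesis using mob_inv_mob q_in that(2) by metis
  qed
  then show ?thesis by (auto simp: deck_transformations_def)
qed

lemma ab_orbit_mob: "ab_orbit U (mob \<circ> q) = ab_orbit U q"
  by (rule ext) (simp add: ab_orbit_def deck_transformations_mob)

lemma universal_abelian_cover_mob: "universal_abelian_cover U (mob \<circ> q) = universal_abelian_cover U q"
  by (simp add: universal_abelian_cover_def ab_orbit_mob)

abbreviation orb :: "'u \<Rightarrow> 'u set" where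
  "orb \<equiv> ab_orbit U (mob \<circ> q)"

abbreviation pr :: "'u set \<Rightarrow> cp1" where
  "pr \<equiv> ab_proj q"

lemma pr_orbit:
  assumes "x \<in> U"
  shows "pr (orb x) = q x"
  unfolding ab_proj_def
proof (rule the_elem_orbit[OF assms])
  fix g assume "g \<in> D"
  then have "g \<in> deck_transformations U q"
    using D_subset unfolding deck_transformations_mob by blast
  then show "q (g x) = q x" using assms by (simp add: deck_transformations_def)
qed

lemma exp_\<Phi>:
  assumes "m \<in> topspace M"
  shows "exp (fst (\<Phi> m)) = mob (pr m)" "exp (snd (\<Phi> m)) = mob (pr m) - 1" "pr m \<in> punctured_cp1"
proof -
  obtain x where x: "x \<in> U" "m = orb x" using assms by (auto simp: topspace_M)
  then show "exp (fst (\<Phi> m)) = mob (pr m)" "exp (snd (\<Phi> m)) = mob (pr m) - 1" "pr m \<in> punctured_cp1"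
    by (simp_all add: \<Phi>_orbit pr_orbit \<Lambda>_def L0 L1 q_in)
qed

lemma continuous_\<Phi>_lift:
  assumes "continuous_map (top_of_set B) M u"
  shows "continuous_on B (\<lambda>w. fst (\<Phi> (u w)))" "continuous_on B (\<lambda>w. snd (\<Phi> (u w)))"
    "w \<in> B \<Longrightarrow> u w \<in> topspace M"
proof -
  have "continuous_on B (\<Phi> \<circ> u)"
    using continuous_map_compose[OF assms continuous_\<Phi>] by simp
  then show "continuous_on B (\<lambda>w. fst (\<Phi> (u w)))" "continuous_on B (\<lambda>w. snd (\<Phi> (u w)))"
    unfolding o_def by (auto intro: continuous_intros)
  show "w \<in> B \<Longrightarrow> u w \<in> topspace M"
    using continuous_map_image_subset_topspace[OF assms] by auto
qed

text \<open>The logarithms along two lifts of the same map differ by constants, which agreement at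
  \<open>w0\<close> makes zero; injectivity of \<open>\<Phi>\<close> turns this into equality in the
  cover.\<close>

lemma lift_unique_M:
  assumes "connected B" and u: "continuous_map (top_of_set B) M u" and v: "continuous_map (top_of_set B) M v"
    and pr: "\<And>w. w \<in> B \<Longrightarrow> pr (u w) = pr (v w)" and w: "w0 \<in> B" "u w0 = v w0" "w \<in> B"
  shows "u w = v w"
proof -
  note U = continuous_\<Phi>_lift[OF u] and V = continuous_\<Phi>_lift[OF v]
  have "fst (\<Phi> (u w)) - fst (\<Phi> (u w0)) = fst (\<Phi> (v w)) - fst (\<Phi> (v w0))"
    using U V pr w exp_\<Phi> by (intro log_diff_constant[OF assms(1) U(1) V(1), of 1]) simp_all
  moreover have "snd (\<Phi> (u w)) - snd (\<Phi> (u w0)) = snd (\<Phi> (v w)) - snd (\<Phi> (v w0))"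
    using U V pr w exp_\<Phi> by (intro log_diff_constant[OF assms(1) U(2) V(2), of 1]) simp_all
  ultimately have "\<Phi> (u w) = \<Phi> (v w)" using w(2) by (simp add: prod_eq_iff)
  then show ?thesis using inj_\<Phi> U(3)[OF w(3)] V(3)[OF w(3)] by (auto dest: inj_onD)
qed

text \<open>The components of \<open>\<Phi> \<circ> s\<close> are continuous logarithms of
  \<open>mob \<circ> \<phi>\<close> and of the same function minus 1, so their derivatives are the
  logarithmic ones.\<close>

lemma lift_has_derivative:
  assumes c: "chart \<phi> d" and s: "local_lift M pr \<phi> z m s"
  shows "((\<Phi> \<circ> s) has_derivative (\<lambda>h. (fst (d z) * h, snd (d z) * h))) (at z)"
proof -
  obtain N where N: "open N" "z \<in> N" "continuous_map (top_of_set N) M s" "\<And>t. t \<in> N \<Longrightarrow> pr (s t) = \<phi> t"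
    using s by (auto simp: local_lift_def)
  note S = continuous_\<Phi>_lift[OF N(3)]
  have z: "\<phi> z \<in> punctured_cp1" using exp_\<Phi>(3)[OF S(3)[OF N(2)]] N by simp
  have d: "((\<lambda>t. mob (\<phi> t)) has_field_derivative mob (\<phi> z) * fst (d z)) (at z)"
    "mob (\<phi> z) * fst (d z) = (mob (\<phi> z) - 1) * snd (d z)"
    using c z by (auto simp: chart_def)
  have f1: "((\<lambda>t. fst (\<Phi> (s t))) has_field_derivative fst (d z)) (at z)"
    by (rule has_field_derivative_log[OF N(1,2) S(1) _ d(1)]) (use exp_\<Phi> S(3) N in simp)
  have d2: "((\<lambda>t. mob (\<phi> t) - 1) has_field_derivative (mob (\<phi> z) - 1) * snd (d z)) (at z)"
    using DERIV_diff[OF d(1) DERIV_const[of 1]] d(2) by simp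
  have "((\<lambda>t. snd (\<Phi> (s t))) has_field_derivative snd (d z)) (at z)"
    by (rule has_field_derivative_log[OF N(1,2) S(2) _ d2]) (use exp_\<Phi> S(3) N in simp)
  with f1 have "((\<lambda>t. (fst (\<Phi> (s t)), snd (\<Phi> (s t)))) has_derivative (\<lambda>h. (fst (d z) * h, snd (d z) * h))) (at z)"
    by (intro has_derivative_Pair) (simp_all add: has_field_derivative_def)
  then show ?thesis by (simp add: o_def)
qed

text \<open>The lift passes from the coordinate to \<open>w\<close>, follows a local section of
  \<open>mob \<circ> q\<close> through a point of the orbit \<open>m\<close>, and projects to
  orbits.\<close>

lemma local_lift_exists:
  assumes c: "chart \<phi> d" and m: "m \<in> topspace M" "pr m = \<phi> z"
  obtains s where "local_lift M pr \<phi> z m s"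
proof -
  obtain x where x: "x \<in> U" "m = orb x" using m by (auto simp: topspace_M)
  then have qx: "q x = \<phi> z" using m pr_orbit by simp
  obtain V \<sigma> where V: "openin (top_of_set (- {0, 1})) V" "(mob \<circ> q) x \<in> V" "continuous_on V \<sigma>"
      "\<sigma> ` V \<subseteq> U" "\<sigma> ((mob \<circ> q) x) = x" "\<And>w. w \<in> V \<Longrightarrow> (mob \<circ> q) (\<sigma> w) = w"
    by (rule local_section[OF x(1)]; (assumption | (rule that; assumption)))
  have V_open: "open V" using V(1) open_base by (simp add: openin_open_eq)
  let ?E = "{t. \<phi> t \<in> punctured_cp1}"
  define N where "N = ?E \<inter> (\<lambda>t. mob (\<phi> t)) -` V"
  have cont: "continuous_on ?E (\<lambda>t. mob (\<phi> t))"
    using c by (intro DERIV_continuous_on) (auto simp: chart_def intro: has_field_derivative_at_within)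
  have N: "open N" "z \<in> N"
    using c V_open cont V(2) q_in[OF x(1)]
    by (auto simp: N_def chart_def qx intro: continuous_open_preimage)
  define s where "s = (\<lambda>t. orb (\<sigma> (mob (\<phi> t))))"
  have "continuous_on N (\<lambda>t. \<sigma> (mob (\<phi> t)))"
    by (rule continuous_on_compose2[OF V(3) continuous_on_subset[OF cont]]) (auto simp: N_def)
  then have "continuous_map (top_of_set N) (top_of_set U) (\<lambda>t. \<sigma> (mob (\<phi> t)))"
    using V(4) by (auto simp: N_def)
  from continuous_map_compose[OF this quotient_imp_continuous_map[OF quotient_map_orbit]]
  have "continuous_map (top_of_set N) M s" by (simp add: s_def o_def)
  moreover have "s z = m" using V(5) x qx by (simp add: s_def)
  moreover have "pr (s t) = \<phi> t" if "t \<in> N" for t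
  proof -
    have t: "\<phi> t \<in> punctured_cp1" "mob (\<phi> t) \<in> V" using that by (auto simp: N_def)
    then have "\<sigma> (mob (\<phi> t)) \<in> U" using V(4) by blast
    moreover have "mob (q (\<sigma> (mob (\<phi> t)))) = mob (\<phi> t)" using V(6)[OF t(2)] by simp
    ultimately show ?thesis using t(1) q_in mob_inv_mob unfolding s_def by (metis pr_orbit)
  qed
  ultimately have "local_lift M pr \<phi> z m s" using N unfolding local_lift_def by blast
  then show ?thesis by (rule that)
qed

lemma differential_scherk_map:
  assumes c: "chart \<phi> d" and m: "m \<in> topspace M" "pr m = \<phi> z"
  shows "has_differential M pr (scherk_map \<circ> \<Phi>) \<phi> z m (\<lambda>h. scherk_map (fst (d z) * h, snd (d z) * h))"
proof -
  obtain s where s: "local_lift M pr \<phi> z m s" by (rule local_lift_exists[OF c m])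
  have "((\<lambda>t. scherk_map ((\<Phi> \<circ> s) t)) has_derivative (\<lambda>h. scherk_map (fst (d z) * h, snd (d z) * h))) (at z)"
    using linear_scherk_map
    by (intro bounded_linear.has_derivative[OF _ lift_has_derivative[OF c s]]) (simp add: linear_conv_bounded_linear)
  then show ?thesis unfolding has_differential_def using s by (auto simp: o_def)
qed

lemma scherk_surface_scherk_map: "scherk_surface M pr (scherk_map \<circ> \<Phi>)"
  unfolding scherk_surface_def
proof (intro ballI conjI allI impI)
  fix m z assume m: "m \<in> topspace M" and z: "pr m = aff z"
  have "scherk_form z = (\<lambda>h. scherk_map (fst (dlog_aff z) * h, snd (dlog_aff z) * h))"
    using exp_\<Phi>(3)[OF m] z by (intro ext scherk_form_eq_scherk_map) simp
  then show "has_differential M pr (scherk_map \<circ> \<Phi>) aff z m (scherk_form z)"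
    using differential_scherk_map[OF chart_aff m z] by simp
next
  fix m z assume m: "m \<in> topspace M" and z: "pr m = aff_inf z"
  have "scherk_form_inf z = (\<lambda>h. scherk_map (fst (dlog_aff_inf z) * h, snd (dlog_aff_inf z) * h))"
    using exp_\<Phi>(3)[OF m] z by (intro ext scherk_form_inf_eq_scherk_map) simp
  then show "has_differential M pr (scherk_map \<circ> \<Phi>) aff_inf z m (scherk_form_inf z)"
    using differential_scherk_map[OF chart_aff_inf m z] by simp
qed

text \<open>The lift that witnesses \<open>has_differential\<close>, composed with the change of
  coordinates \<open>k\<close>, and the projected section have the same image under
  \<open>pr\<close> and meet at \<open>w\<close>. By \<open>lift_unique_M\<close> they agree near
  \<open>w\<close>, so the chain rule gives an ordinary derivative in the coordinate of the
  base.\<close>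

lemma derivative_along_section:
  assumes B: "open B" "w \<in> B" "continuous_on B \<sigma>" "\<sigma> ` B \<subseteq> U" "\<And>w. w \<in> B \<Longrightarrow> (mob \<circ> q) (\<sigma> w) = w"
    and k: "open N" "w \<in> N" "continuous_on N k" "(k has_derivative k') (at w)" "\<And>t. t \<in> N \<Longrightarrow> \<phi> (k t) = mob_inv t"
    and f: "has_differential M pr f \<phi> (k w) (orb (\<sigma> w)) D'"
  shows "((\<lambda>w. f (orb (\<sigma> w))) has_derivative (\<lambda>h. D' (k' h))) (at w)"
proof -
  obtain s S where s: "s (k w) = orb (\<sigma> w)" "open S" "k w \<in> S" "continuous_map (top_of_set S) M s"
    "\<And>t. t \<in> S \<Longrightarrow> pr (s t) = \<phi> t" "((f \<circ> s) has_derivative D') (at (k w))"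
    using f unfolding has_differential_def local_lift_def by blast
  have "open (N \<inter> k -` S)" by (rule continuous_open_preimage[OF k(3,1) s(2)])
  then have "open (B \<inter> (N \<inter> k -` S))" using B(1) by blast
  moreover have "w \<in> B \<inter> (N \<inter> k -` S)" using B k s by blast
  ultimately obtain e where e: "e > 0" "ball w e \<subseteq> B \<inter> (N \<inter> k -` S)"
    using openE by blast
  have "continuous_map (top_of_set (ball w e)) (top_of_set S) k"
    using e continuous_on_subset[OF k(3)] by auto
  from continuous_map_compose[OF this s(4)]
  have cu: "continuous_map (top_of_set (ball w e)) M (s \<circ> k)" .
  have "continuous_map (top_of_set (ball w e)) (top_of_set U) \<sigma>"
    using e B(4) continuous_on_subset[OF B(3)] by auto
  from continuous_map_compose[OF this quotient_imp_continuous_map[OF quotient_map_orbit]]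
  have cv: "continuous_map (top_of_set (ball w e)) M (orb \<circ> \<sigma>)" .
  have pr: "pr ((s \<circ> k) t) = pr ((orb \<circ> \<sigma>) t)" if t: "t \<in> ball w e" for t
  proof -
    have "t \<in> B" "t \<in> N" "k t \<in> S" using e t by auto
    then have "pr (s (k t)) = mob_inv t" using s k by simp
    moreover have "\<sigma> t \<in> U" using \<open>t \<in> B\<close> B(4) by blast
    moreover have "q (\<sigma> t) = mob_inv t"
      using B(5)[OF \<open>t \<in> B\<close>] mob_inv_mob[OF q_in[OF \<open>\<sigma> t \<in> U\<close>]] by simp
    ultimately show ?thesis by (simp add: pr_orbit)
  qed
  have eq: "(s \<circ> k) t = (orb \<circ> \<sigma>) t" if "t \<in> ball w e" for t
    by (rule lift_unique_M[OF connected_ball cu cv pr, of w]) (use e s(1) that in auto)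
  have "((f \<circ> s) \<circ> k has_derivative D' \<circ> k') (at w)"
    by (rule diff_chain_at[OF k(4) s(6)])
  then have "((\<lambda>t. f (s (k t))) has_derivative (\<lambda>h. D' (k' h))) (at w)" by (simp add: o_def)
  then show ?thesis
  proof (rule has_derivative_transform_within_open)
    show "open (ball w e)" "w \<in> ball w e" using e by auto
    show "f (s (k t)) = f (orb (\<sigma> t))" if "t \<in> ball w e" for t
      using eq[OF that] by simp
  qed
qed

text \<open>Pulled back to \<open>U\<close>, the difference of two primitives has zero derivative
  along every local section. As images of sections are open, it is locally constant on the connected
  set \<open>U\<close>.\<close>

lemma scherk_surface_unique:
  assumes "scherk_surface M pr f" "scherk_surface M pr g"
  obtains c where "\<And>m. m \<in> topspace M \<Longrightarrow> f m = g m + c"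
proof -
  define h where "h x = f (orb x) - g (orb x)" for x
  have "h constant_on U"
  proof (rule locally_constant_imp_constant[OF connected_U])
    fix x assume x: "x \<in> U"
    obtain V \<sigma> where V: "openin (top_of_set (- {0, 1})) V" "(mob \<circ> q) x \<in> V" "continuous_on V \<sigma>"
        "\<sigma> ` V \<subseteq> U" "\<sigma> ((mob \<circ> q) x) = x" "\<And>w. w \<in> V \<Longrightarrow> (mob \<circ> q) (\<sigma> w) = w"
      by (rule local_section[OF x]; (assumption | (rule that; assumption)))
    have "open V" using V(1) open_base by (simp add: openin_open_eq)
    then obtain e where e: "e > 0" "ball (mob (q x)) e \<subseteq> V" using V(2) openE by (metis o_apply)
    let ?B = "ball (mob (q x)) e"
    have B: "continuous_on ?B \<sigma>" "\<sigma> ` ?B \<subseteq> U" "\<And>w. w \<in> ?B \<Longrightarrow> (mob \<circ> q) (\<sigma> w) = w"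
      using e V continuous_on_subset[OF V(3)] by auto
    have der: "((\<lambda>w. h (\<sigma> w)) has_derivative (\<lambda>h. 0)) (at w)" if w: "w \<in> ?B" for w
    proof -
      obtain \<phi> k N where k: "\<phi> \<in> {aff, aff_inf}" "open N" "w \<in> N" "k holomorphic_on N"
          "\<And>t. t \<in> N \<Longrightarrow> \<phi> (k t) = mob_inv t"
        by (rule mob_inv_in_chart[of w]; (assumption | (rule that; assumption)))
      obtain k' where k': "(k has_field_derivative k') (at w)"
        using holomorphic_derivI[OF k(4,2,3)] by blast
      then have k'': "(k has_derivative (\<lambda>h. k' * h)) (at w)" by (simp add: has_field_derivative_def)
      have \<sigma>w: "\<sigma> w \<in> U" using B(2) w by blast
      then have m: "orb (\<sigma> w) \<in> topspace M" by (simp add: topspace_M)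
      have "q (\<sigma> w) = mob_inv w" using B(3)[OF w] mob_inv_mob[OF q_in[OF \<sigma>w]] by simp
      then have prm: "pr (orb (\<sigma> w)) = \<phi> (k w)" using k(3,5) \<sigma>w by (simp add: pr_orbit)
      \<comment> \<open>In either chart both differentials are the value of the same form, so one
        \<open>D'\<close> serves for \<open>f\<close> and \<open>g\<close>.\<close>
      have "\<exists>D'. has_differential M pr f \<phi> (k w) (orb (\<sigma> w)) D' \<and> has_differential M pr g \<phi> (k w) (orb (\<sigma> w)) D'"
        using assms m prm k(1) unfolding scherk_surface_def by blast
      then obtain D' where D': "has_differential M pr f \<phi> (k w) (orb (\<sigma> w)) D'"
          "has_differential M pr g \<phi> (k w) (orb (\<sigma> w)) D'" by blast
      have df: "((\<lambda>w. f (orb (\<sigma> w))) has_derivative (\<lambda>h. D' (k' * h))) (at w)"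
        by (rule derivative_along_section[OF open_ball w B k(2,3) holomorphic_on_imp_continuous_on[OF k(4)] k'' k(5) D'(1)])
      have dg: "((\<lambda>w. g (orb (\<sigma> w))) has_derivative (\<lambda>h. D' (k' * h))) (at w)"
        by (rule derivative_along_section[OF open_ball w B k(2,3) holomorphic_on_imp_continuous_on[OF k(4)] k'' k(5) D'(2)])
      show ?thesis unfolding h_def using has_derivative_diff[OF df dg] by simp
    qed
    have "\<exists>c. \<forall>w\<in>?B. h (\<sigma> w) = c"
      by (rule has_derivative_zero_constant[OF convex_ball]) (rule has_derivative_at_withinI[OF der])
    then have "\<forall>w\<in>?B. h (\<sigma> w) = h (\<sigma> (mob (q x)))" using e(1) by (metis centre_in_ball)
    then have const: "\<forall>y\<in>\<sigma> ` ?B. h y = h x" using V(5) by simp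
    have "?B \<subseteq> - {0, 1}" using e(2) openin_subset[OF V(1)] by auto
    then have "openin (top_of_set (- {0, 1})) ?B" by (simp add: openin_open_eq open_base)
    then have "openin (top_of_set U) (\<sigma> ` ?B)" using B by (intro openin_section)
    moreover have "x \<in> \<sigma> ` ?B" using V(5) e(1) by (metis centre_in_ball imageI o_apply)
    ultimately show "\<exists>T. openin (top_of_set U) T \<and> x \<in> T \<and> (\<forall>y\<in>T. h y = h x)" using const by blast
  qed
  then obtain c where "\<And>x. x \<in> U \<Longrightarrow> h x = c" by (auto simp: constant_on_def)
  then have "f m = g m + c" if "m \<in> topspace M" for m
    using that by (auto simp: topspace_M h_def algebra_simps)
  then show ?thesis by (rule that)
qed

section \<open>Immersion, embedding and properness\<close>

lemma immersion_scherk_surface: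
  assumes "scherk_surface M pr f"
  shows "immersion M pr f"
  unfolding immersion_def
proof
  fix m assume m: "m \<in> topspace M"
  have inj: "inj (\<lambda>h. scherk_map (fst (d z) * h, snd (d z) * h))" if "chart \<phi> d" "pr m = \<phi> z" for \<phi> d z
  proof (rule injI)
    fix h h' assume "scherk_map (fst (d z) * h, snd (d z) * h) = scherk_map (fst (d z) * h', snd (d z) * h')"
    then have "fst (d z) * h = fst (d z) * h'" using injD[OF inj_scherk_map] by blast
    \<comment> \<open>Since \<open>mob\<close> is a local coordinate, the first logarithm alone
      already has a nonzero derivative.\<close>
    moreover have "fst (d z) \<noteq> 0" using that exp_\<Phi>(3)[OF m] by (simp add: chart_def)
    ultimately show "h = h'" by simp
  qed
  consider z where "pr m = aff z" | w where "pr m = aff_inf w" by (rule cp1_chart_cases)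
  then show "\<exists>\<phi>\<in>{aff, aff_inf}. \<exists>z D. pr m = \<phi> z \<and> has_differential M pr f \<phi> z m D \<and> inj D"
  proof cases
    case (1 z)
    have "scherk_form z = (\<lambda>h. scherk_map (fst (dlog_aff z) * h, snd (dlog_aff z) * h))"
      using exp_\<Phi>(3)[OF m] 1 by (intro ext scherk_form_eq_scherk_map) simp
    then have "inj (scherk_form z)" using inj[OF chart_aff 1] by simp
    then show ?thesis using assms m 1 unfolding scherk_surface_def by blast
  next
    case (2 w)
    have "scherk_form_inf w = (\<lambda>h. scherk_map (fst (dlog_aff_inf w) * h, snd (dlog_aff_inf w) * h))"
      using exp_\<Phi>(3)[OF m] 2 by (intro ext scherk_form_inf_eq_scherk_map) simp
    then have "inj (scherk_form_inf w)" using inj[OF chart_aff_inf 2] by simp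
    then show ?thesis using assms m 2 unfolding scherk_surface_def by blast
  qed
qed

lemma properly_embedded_scherk_surface:
  assumes f: "scherk_surface M pr f"
  shows "properly_embedded M pr f"
proof -
  obtain c where c: "\<And>m. m \<in> topspace M \<Longrightarrow> f m = (scherk_map \<circ> \<Phi>) m + c"
    by (rule scherk_surface_unique[OF f scherk_surface_scherk_map]) (rule that)
  define E where "E v = scherk_map v + c" for v
  \<comment> \<open>A linear left inverse provides the continuous inverse of \<open>E\<close> on its
    image.\<close>
  obtain T where T: "linear T" "T \<circ> scherk_map = id"
    using linear_injective_left_inverse[OF linear_scherk_map inj_scherk_map] by blast
  then have TE: "T (E v - c) = v" for v by (metis E_def add_diff_cancel_right' comp_apply id_apply)
  have "E ` log_curve = (+) c ` (scherk_map ` log_curve)"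
    by (auto simp: E_def image_image add.commute)
  \<comment> \<open>An injective linear map between finite-dimensional spaces preserves closedness,
    and so does a translation.\<close>
  then have closed: "closed (E ` log_curve)"
    using closed_translation[OF closed_injective_linear_image[OF closed_log_curve linear_scherk_map inj_scherk_map]]
    by simp
  have contE: "continuous_on A E" for A
    unfolding E_def using linear_continuous_on[of scherk_map A] linear_scherk_map
    by (intro continuous_intros) (simp add: linear_conv_bounded_linear)
  have contT: "continuous_on A (\<lambda>v. T (v - c))" for A
    using T(1) by (intro continuous_on_compose2[OF linear_continuous_on[of T UNIV]] continuous_intros)
      (auto simp: linear_conv_bounded_linear)
  have "homeomorphic_maps (top_of_set log_curve) (top_of_set (E ` log_curve)) E (\<lambda>v. T (v - c))"
    using contE contT TE by (auto simp: homeomorphic_maps_def)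
  then have "homeomorphic_map (top_of_set log_curve) (top_of_set (E ` log_curve)) E"
    using homeomorphic_map_maps by blast
  from homeomorphic_map_compose[OF homeomorphic_map_\<Phi> this]
  have hom: "homeomorphic_map M (top_of_set (E ` log_curve)) f"
    by (rule homeomorphic_map_eq) (simp add: c E_def)
  have "f ` topspace M = E ` log_curve"
    using homeomorphic_imp_surjective_map[OF hom] by simp
  then have "embedding_map M euclidean f" using hom by (simp add: embedding_map_def)
  moreover have "proper_map M euclidean f"
  proof -
    \<comment> \<open>A closed set meets every compact set in a compact set, so its inclusion is
      proper; \<open>f\<close> is a homeomorphism onto this set followed by the inclusion.\<close>
    have "proper_map (top_of_set (E ` log_curve)) euclidean id"
      using closed by (simp add: proper_map_inclusion closed_Int_compact)
    from proper_map_compose[OF homeomorphic_imp_proper_map[OF hom] this]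
    show ?thesis by simp
  qed
  ultimately show ?thesis
    unfolding properly_embedded_def using immersion_scherk_surface[OF f] by blast
qed

end

text \<open>The first conjunct ensures that the second is not vacuous; the second covers every
  choice of the additive constant in the primitive.\<close>

theorem corollary7p2:
  fixes U :: "'u::real_normed_vector set" and q :: "'u \<Rightarrow> cp1"
  assumes "universal_covering U q punctured_cp1"
  shows "(\<exists>f. scherk_surface (universal_abelian_cover U q) (ab_proj q) f) \<and>
    (\<forall>f. scherk_surface (universal_abelian_cover U q) (ab_proj q) f \<longrightarrow>
         properly_embedded (universal_abelian_cover U q) (ab_proj q) f)"
proof -
  interpret universal_abelian_covering U q by unfold_locales (rule assms)
  show ?thesis
    using scherk_surface_scherk_map properly_embedded_scherk_surface
    unfolding universal_abelian_cover_mob by blast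
qed

end
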